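(* Let $k$ be a field with algebraic closure $\overline{k}$, $H$ a finite abelian group, and $l$ a Galois extension of $k$ with group $H$. Equip $\mathrm{End}_k(l)$ with the $H$-grading transported from $\Delta(l,H)$ along the isomorphism $j:\Delta(l,H)\to\mathrm{End}_k(l)$. Then this grading is a form of the good grading on $\mathrm{End}_k(kH)$, i.e. $\overline{k}\otimes_k\mathrm{End}_k(l)\cong\mathrm{END}_{\overline{k}}(\overline{k}H)$ as $H$-graded $\overline{k}$-algebras.
   Context: For a commutative $k$-algebra $l$ on which $H$ acts by $k$-algebra automorphisms, $\Delta(l,H)=\bigoplus_{\sigma\in H}lu_\sigma$ is the $k$-algebra with multiplication $(au_\sigma)(bu_\tau)=a\sigma(b)u_{\sigma\tau}$ for $a,b\in l$, and $H$-grading in which $\Delta(l,H)_\sigma=lu_\sigma$. There is a $k$-algebra map $j:\Delta(l,H)\to\mathrm{End}_k(l)$, $j(au_\sigma)(b)=a\sigma(b)$. The algebra $l$ (not necessarily a field) is a Galois extension of $k$ with group $H$ if and only if $l^H=k$ and $j$ is an isomorphism. The group algebra $kH$ is an $H$-graded vector space with $h\in H$ of degree $h$. For a finite dimensional $H$-graded vector space $V$, $\mathrm{END}_k(V)$ denotes $\mathrm{End}_k(V)$ with the $H$-grading $\mathrm{END}_k(V)_\sigma=\{f\mid f(V_g)\subseteq V_{\sigma g}\ \forall g\in H\}$; the good grading on $\mathrm{End}_k(kH)$ is $\mathrm{END}_k(kH)$. Isomorphisms of graded algebras preserve degrees. *)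

theory Defs
  imports
    "HOL-Algebra.Free_Abelian_Groups"
    "HOL-Algebra.Module"
    "HOL-Algebra.QuotRing"
    "HOL-Algebra.Algebraic_Closure_Type"
begin

text \<open>
  Ground fields and commutative algebras are types, and a finite group \<open>H\<close> is a
  finite type of class \<open>group_add\<close>, written additively. Noncommutative algebras are
  \<open>module\<close> records whose scalars range over the whole field type.
\<close>

section \<open>Algebraic closures\<close>

locale algebraic_closure_map =
  fixes \<iota> :: "'k::field \<Rightarrow> 'c::alg_closed_field"
  assumes map_one: "\<iota> 1 = 1"
    and map_add: "\<iota> (x + y) = \<iota> x + \<iota> y"
    and map_mult: "\<iota> (x * y) = \<iota> x * \<iota> y"
    and algebraic: "\<exists>p. p \<noteq> 0 \<and> poly (map_poly \<iota> p) z = 0"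

lemma algebraic_closure_map_to_ac: "algebraic_closure_map (to_ac :: 'k::field \<Rightarrow> 'k alg_closure)"
  by unfold_locales (use alg_closure_algebraic in \<open>auto\<close>)


section \<open>Isomorphisms of algebras and of graded algebras\<close>

text \<open>A family \<open>gr\<close> of subsets of the carrier indexed by \<open>'h\<close> encodes an \<open>H\<close>-grading.\<close>

definition algebra_iso :: "('k, 'a, 'm) module_scheme \<Rightarrow> ('k, 'b, 'n) module_scheme \<Rightarrow> ('a \<Rightarrow> 'b) set"
  where "algebra_iso A B =
    {f \<in> ring_iso A B. \<forall>c. \<forall>x\<in>carrier A. f (c \<odot>\<^bsub>A\<^esub> x) = c \<odot>\<^bsub>B\<^esub> f x}"

definition graded_algebra_iso ::
  "('k, 'a, 'm) module_scheme \<Rightarrow> ('h \<Rightarrow> 'a set) \<Rightarrow> ('k, 'b, 'n) module_scheme \<Rightarrow> ('h \<Rightarrow> 'b set)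
    \<Rightarrow> ('a \<Rightarrow> 'b) set"
  where "graded_algebra_iso A grA B grB = {f \<in> algebra_iso A B. \<forall>\<sigma>. f ` grA \<sigma> = grB \<sigma>}"


section \<open>Endomorphism algebras\<close>

definition End_alg :: "('k::field \<Rightarrow> 'v::ab_group_add \<Rightarrow> 'v) \<Rightarrow> ('k, 'v \<Rightarrow> 'v) module"
  where "End_alg scale =
    \<lparr>carrier = {f. Vector_Spaces.linear scale scale f},
     monoid.mult = (\<circ>), one = id,
     zero = (\<lambda>_. 0), add = (\<lambda>f g x. f x + g x),
     module.smult = (\<lambda>c f x. scale c (f x))\<rparr>"

text \<open>The grading of \<open>END(V)\<close>, where \<open>V g\<close> is the component of degree \<open>g\<close>.\<close>

definition END_grading ::
  "('k::field \<Rightarrow> 'v::ab_group_add \<Rightarrow> 'v) \<Rightarrow> ('h::group_add \<Rightarrow> 'v set) \<Rightarrow> 'h \<Rightarrow> ('v \<Rightarrow> 'v) set"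
  where "END_grading scale V \<sigma> = {f \<in> carrier (End_alg scale). \<forall>g. f ` V g \<subseteq> V (\<sigma> + g)}"


section \<open>The group algebra as a graded vector space\<close>

text \<open>The group algebra is the type \<open>'h \<Rightarrow>\<^sub>0 'c\<close>; the basis element \<open>h\<close> is \<open>single h 1\<close>.\<close>

definition group_alg_scale :: "'c::field \<Rightarrow> ('h \<Rightarrow>\<^sub>0 'c) \<Rightarrow> ('h \<Rightarrow>\<^sub>0 'c)"
  where "group_alg_scale c = Poly_Mapping.map ((*) c)"

definition group_alg_comp :: "'h \<Rightarrow> ('h \<Rightarrow>\<^sub>0 'c::field) set"
  where "group_alg_comp h = {group_alg_scale c (Poly_Mapping.single h 1) | c. True}"

lemma lookup_group_alg_scale:
  "Poly_Mapping.lookup (group_alg_scale c p) h = c * Poly_Mapping.lookup p h"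
  by (simp add: group_alg_scale_def Poly_Mapping.map.rep_eq when_def)

lemma vector_space_group_alg_scale: "vector_space group_alg_scale"
  by unfold_locales
    (auto intro!: poly_mapping_eqI simp: lookup_group_alg_scale lookup_add algebra_simps)


section \<open>Skew group algebras and Galois extensions\<close>

locale algebra_with_action = vector_space scale
  for scale :: "'k::field \<Rightarrow> 'l::comm_ring_1 \<Rightarrow> 'l" +
  fixes act :: "'h::{group_add,finite} \<Rightarrow> 'l \<Rightarrow> 'l"
  assumes scale_mult_left: "scale c x * y = scale c (x * y)"
    and act_zero: "act 0 x = x"
    and act_compose: "act (\<sigma> + \<tau>) x = act \<sigma> (act \<tau> x)"
    and act_add: "act \<sigma> (x + y) = act \<sigma> x + act \<sigma> y"
    and act_mult: "act \<sigma> (x * y) = act \<sigma> x * act \<sigma> y"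
    and act_one: "act \<sigma> 1 = 1"
    and act_scale: "act \<sigma> (scale c x) = scale c (act \<sigma> x)"

text \<open>The element \<open>a u\<^sub>\<sigma>\<close> of \<open>\<Delta>(l,H)\<close> is \<open>single \<sigma> a\<close>.\<close>

definition skew_mult ::
  "('h::group_add \<Rightarrow> 'l::comm_ring_1 \<Rightarrow> 'l) \<Rightarrow> ('h \<Rightarrow>\<^sub>0 'l) \<Rightarrow> ('h \<Rightarrow>\<^sub>0 'l) \<Rightarrow> ('h \<Rightarrow>\<^sub>0 'l)"
  where "skew_mult act x y =
    (\<Sum>\<sigma>\<in>Poly_Mapping.keys x. \<Sum>\<tau>\<in>Poly_Mapping.keys y.
      Poly_Mapping.single (\<sigma> + \<tau>) (Poly_Mapping.lookup x \<sigma> * act \<sigma> (Poly_Mapping.lookup y \<tau>)))"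

definition skew_group_alg ::
  "('k::field \<Rightarrow> 'l::comm_ring_1 \<Rightarrow> 'l) \<Rightarrow> ('h::group_add \<Rightarrow> 'l \<Rightarrow> 'l) \<Rightarrow> ('k, 'h \<Rightarrow>\<^sub>0 'l) module"
  where "skew_group_alg scale act =
    \<lparr>carrier = UNIV, monoid.mult = skew_mult act, one = Poly_Mapping.single 0 1,
     zero = 0, add = (+), module.smult = (\<lambda>c. Poly_Mapping.map (scale c))\<rparr>"

definition skew_group_alg_comp :: "'h \<Rightarrow> ('h \<Rightarrow>\<^sub>0 'l::comm_ring_1) set"
  where "skew_group_alg_comp \<sigma> = {Poly_Mapping.single \<sigma> a | a. True}"

definition skew_to_End :: "('h \<Rightarrow> 'l::comm_ring_1 \<Rightarrow> 'l) \<Rightarrow> ('h \<Rightarrow>\<^sub>0 'l) \<Rightarrow> 'l \<Rightarrow> 'l"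
  where "skew_to_End act x b = (\<Sum>\<sigma>\<in>Poly_Mapping.keys x. Poly_Mapping.lookup x \<sigma> * act \<sigma> b)"

lemma (in algebra_with_action) skew_mult_single:
  "skew_mult act (Poly_Mapping.single \<sigma> a) (Poly_Mapping.single \<tau> b)
    = Poly_Mapping.single (\<sigma> + \<tau>) (a * act \<sigma> b)"
proof -
  have "act \<sigma> 0 = 0"
    using act_scale[of \<sigma> 0 0] by simp
  then show ?thesis
    by (cases "a = 0"; cases "b = 0") (simp_all add: skew_mult_def)
qed

lemma skew_to_End_single: "skew_to_End act (Poly_Mapping.single \<sigma> a) b = a * act \<sigma> b"
  by (cases "a = 0") (simp_all add: skew_to_End_def)

text \<open>
  The condition \<open>l\<^sup>H = k\<close> refers to the structure map \<open>c \<mapsto> scale c 1\<close>, which is injective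
  because \<open>0 \<noteq> 1\<close> in a type of class \<open>comm_ring_1\<close>.
\<close>

locale galois_extension = algebra_with_action scale act
  for scale :: "'k::field \<Rightarrow> 'l::comm_ring_1 \<Rightarrow> 'l"
    and act :: "'h::{group_add,finite} \<Rightarrow> 'l \<Rightarrow> 'l" +
  assumes fixed_ring: "{x. \<forall>\<sigma>. act \<sigma> x = x} = {scale c 1 | c. True}"
    and skew_to_End_iso: "skew_to_End act \<in> algebra_iso (skew_group_alg scale act) (End_alg scale)"

definition transported_grading :: "('h \<Rightarrow> 'l::comm_ring_1 \<Rightarrow> 'l) \<Rightarrow> 'h \<Rightarrow> ('l \<Rightarrow> 'l) set"
  where "transported_grading act \<sigma> = skew_to_End act ` skew_group_alg_comp \<sigma>"


section \<open>Extension of scalars\<close>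

text \<open>
  The tensor product of \<open>'c\<close> and \<open>A\<close> over \<open>'k\<close>, where \<open>'c\<close> is a \<open>'k\<close>-algebra via \<open>\<iota>\<close>, is the
  free abelian group on pairs \<open>(x, a)\<close> modulo the subgroup generated by the bilinearity and
  balancing relations. The multiplication \<open>(x, a) (y, b) = (x y, a b)\<close> of generators makes the
  free group a ring. If \<open>A\<close> is a \<open>'k\<close>-algebra, then that subgroup is a two-sided ideal, and the
  tensor product is the quotient ring.
\<close>

definition pairs_ring :: "('k, 'a, 'm) module_scheme \<Rightarrow> (('c::field \<times> 'a) \<Rightarrow>\<^sub>0 int) ring"
  where "pairs_ring A =
    \<lparr>carrier = carrier (free_Abelian_group (UNIV \<times> carrier A)),
     monoid.mult = (\<lambda>p q. \<Sum>u\<in>Poly_Mapping.keys p. \<Sum>v\<in>Poly_Mapping.keys q.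
       Poly_Mapping.single (fst u * fst v, snd u \<otimes>\<^bsub>A\<^esub> snd v)
         (Poly_Mapping.lookup p u * Poly_Mapping.lookup q v)),
     one = Poly_Mapping.single (1, \<one>\<^bsub>A\<^esub>) 1,
     zero = 0, add = (+)\<rparr>"

definition tensor_relations ::
  "('k \<Rightarrow> 'c::field) \<Rightarrow> ('k, 'a, 'm) module_scheme \<Rightarrow> (('c \<times> 'a) \<Rightarrow>\<^sub>0 int) set"
  where "tensor_relations \<iota> A =
    {Poly_Mapping.single (x + y, a) 1 - Poly_Mapping.single (x, a) 1 - Poly_Mapping.single (y, a) 1
      | x y a. a \<in> carrier A}
    \<union> {Poly_Mapping.single (x, a \<oplus>\<^bsub>A\<^esub> b) 1 - Poly_Mapping.single (x, a) 1 - Poly_Mapping.single (x, b) 1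
      | x a b. a \<in> carrier A \<and> b \<in> carrier A}
    \<union> {Poly_Mapping.single (x * \<iota> c, a) 1 - Poly_Mapping.single (x, c \<odot>\<^bsub>A\<^esub> a) 1
      | x c a. a \<in> carrier A}"

definition tensor_kernel ::
  "('k \<Rightarrow> 'c::field) \<Rightarrow> ('k, 'a, 'm) module_scheme \<Rightarrow> (('c \<times> 'a) \<Rightarrow>\<^sub>0 int) set"
  where "tensor_kernel \<iota> A = generate (free_Abelian_group (UNIV \<times> carrier A)) (tensor_relations \<iota> A)"

definition tensor ::
  "('k \<Rightarrow> 'c::field) \<Rightarrow> ('k, 'a, 'm) module_scheme \<Rightarrow> 'c \<Rightarrow> 'a \<Rightarrow> (('c \<times> 'a) \<Rightarrow>\<^sub>0 int) set"
  where "tensor \<iota> A x a = tensor_kernel \<iota> A +>\<^bsub>pairs_ring A\<^esub> Poly_Mapping.single (x, a) 1"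

text \<open>A scalar \<open>c\<close> acts on the extended algebra as multiplication by \<open>tensor c 1\<close>.\<close>

definition base_change ::
  "('k \<Rightarrow> 'c::field) \<Rightarrow> ('k, 'a, 'm) module_scheme \<Rightarrow> ('c, (('c \<times> 'a) \<Rightarrow>\<^sub>0 int) set) module"
  where "base_change \<iota> A =
    (let Q = pairs_ring A Quot tensor_kernel \<iota> A in
     \<lparr>carrier = carrier Q, monoid.mult = monoid.mult Q, one = monoid.one Q,
      zero = ring.zero Q, add = ring.add Q,
      module.smult = (\<lambda>c t. tensor \<iota> A c \<one>\<^bsub>A\<^esub> \<otimes>\<^bsub>Q\<^esub> t)\<rparr>)"

definition base_change_grading ::
  "('k \<Rightarrow> 'c::field) \<Rightarrow> ('k, 'a, 'm) module_scheme \<Rightarrow> ('h \<Rightarrow> 'a set)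
    \<Rightarrow> 'h \<Rightarrow> (('c \<times> 'a) \<Rightarrow>\<^sub>0 int) set set"
  where "base_change_grading \<iota> A gr \<sigma> =
    generate (add_monoid (base_change \<iota> A)) {tensor \<iota> A x a | x a. a \<in> gr \<sigma>}"

end

theory Submission
  imports Defs "HOL-Analysis.Determinants"
begin

text \<open>
  A Galois extension of \<open>k\<close> becomes trivial after splitting it over an algebraic closure: \<open>c \<otimes> l\<close>
  is the algebra of functions on the group \<open>H\<close>, on which \<open>H\<close> acts by translation. In that model an
  element of \<open>l\<close> acts diagonally and \<open>u\<^sub>\<sigma>\<close> acts as a shift by \<open>\<sigma>\<close>, so \<open>l u\<^sub>\<sigma>\<close> spans exactly the
  endomorphisms of degree \<open>\<sigma>\<close> of the group algebra. The proof makes this concrete.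

  The isomorphism \<open>j\<close> says that each endomorphism of \<open>l\<close> has unique coefficients with respect to the
  maps \<open>act \<sigma>\<close>. Existence bounds the dimension of \<open>l\<close> by the order of \<open>H\<close>
  (\<open>finite_independent\<close>). Uniqueness, applied to coordinate functionals, shows that they are trace
  forms, and produces a basis \<open>B\<close> and a dual family \<open>a\<close> for the trace (\<open>dual_bases\<close>). A point
  \<open>\<pi>\<close>, that is, an algebra homomorphism from \<open>l\<close> to \<open>c\<close> over \<open>k\<close>, is obtained as a common
  eigenvector of the multiplications acting on semilinear functionals (\<open>point_exists\<close>).

  The translates of \<open>\<pi>\<close> define \<open>\<beta>\<close> from \<open>l\<close> to the group algebra. The duality relations, after
  applying \<open>\<pi>\<close>, are precisely the statement that \<open>\<beta>\<close> maps \<open>B\<close> to a basis (\<open>coord_\<beta>\<close>, \<open>coord_expansion\<close>).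
  Conjugation by \<open>\<beta>\<close> then carries the matrix units of \<open>l\<close> to a basis of the endomorphisms of the
  group algebra. This identifies the tensor product with that endomorphism algebra
  (locale \<open>base_change_target\<close>): formal pairs have normal forms over the matrix units, so the kernel
  of the evident map is spanned by the tensor relations. Finally \<open>\<psi>_homogeneous\<close> and
  \<open>generate_homogeneous\<close> compare the gradings.
\<close>


section \<open>Endomorphism algebras\<close>

lemma End_alg_simps [simp]:
  "f \<in> carrier (End_alg s) \<longleftrightarrow> Vector_Spaces.linear s s f"
  "f \<otimes>\<^bsub>End_alg s\<^esub> g = f \<circ> g"
  "\<one>\<^bsub>End_alg s\<^esub> = id"
  "\<zero>\<^bsub>End_alg s\<^esub> = (\<lambda>_. 0)"
  "f \<oplus>\<^bsub>End_alg s\<^esub> g = (\<lambda>x. f x + g x)"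
  "c \<odot>\<^bsub>End_alg s\<^esub> f = (\<lambda>x. s c (f x))"
  by (simp_all add: End_alg_def)

lemma linear_self_iff:
  assumes "vector_space s"
  shows "Vector_Spaces.linear s s f
    \<longleftrightarrow> (\<forall>x y. f (x + y) = f x + f y) \<and> (\<forall>c x. f (s c x) = s c (f x))"
  using assms by (simp add: Vector_Spaces.linear_iff)

lemma ring_End_alg:
  fixes s :: "'k::field \<Rightarrow> 'v::ab_group_add \<Rightarrow> 'v"
  assumes "vector_space s"
  shows "ring (End_alg s)"
proof -
  interpret vector_space s by fact
  have "\<exists>g\<in>carrier (End_alg s). g \<oplus>\<^bsub>End_alg s\<^esub> f = \<zero>\<^bsub>End_alg s\<^esub>"
    if "f \<in> carrier (End_alg s)" for f
    using that by (intro bexI[of _ "\<lambda>x. - f x"]) (auto simp: linear_self_iff[OF assms])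
  then show ?thesis
    by (intro ringI abelian_groupI monoidI)
      (auto simp: linear_self_iff[OF assms] fun_eq_iff algebra_simps scale_left_commute)
qed

lemma finsum_End_alg:
  fixes s :: "'k::field \<Rightarrow> 'v::ab_group_add \<Rightarrow> 'v"
  assumes "vector_space s" and "finite I" and "\<And>i. i \<in> I \<Longrightarrow> Vector_Spaces.linear s s (f i)"
  shows "finsum (End_alg s) f I = (\<lambda>x. \<Sum>i\<in>I. f i x)"
proof -
  interpret ring "End_alg s" by (rule ring_End_alg) fact
  show ?thesis
    using assms(2,3)
  proof (induction I rule: finite_induct)
    case empty
    show ?case by (simp add: fun_eq_iff finsum_empty[simplified])
  next
    case (insert i I)
    then have "finsum (End_alg s) f (insert i I)
        = f i \<oplus>\<^bsub>End_alg s\<^esub> finsum (End_alg s) f I"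
      by (intro finsum_insert) auto
    with insert show ?case by (simp add: fun_eq_iff)
  qed
qed


section \<open>The ring on formal pairs\<close>

text \<open>
  The product on formal pairs as an iterated additive extension, so that additivity in each
  factor is immediate and ring identities reduce to generators.
\<close>
definition pairs_mult ::
  "('k, 'a, 'm) module_scheme \<Rightarrow> (('c::field \<times> 'a) \<Rightarrow>\<^sub>0 int) \<Rightarrow> (('c \<times> 'a) \<Rightarrow>\<^sub>0 int) \<Rightarrow> (('c \<times> 'a) \<Rightarrow>\<^sub>0 int)"
  where "pairs_mult A p q =
    frag_extend (\<lambda>u. frag_extend (\<lambda>v. frag_of (fst u * fst v, snd u \<otimes>\<^bsub>A\<^esub> snd v)) q) p"

lemma frag_cmul_single: "frag_cmul a (Poly_Mapping.single w b) = Poly_Mapping.single w (a * b)"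
  by (rule poly_mapping_eqI) (simp add: lookup_single when_def)

lemma pairs_ring_simps [simp]:
  "p \<in> carrier (pairs_ring A) \<longleftrightarrow> Poly_Mapping.keys p \<subseteq> UNIV \<times> carrier A"
  "p \<otimes>\<^bsub>pairs_ring A\<^esub> q = pairs_mult A p q"
  "\<one>\<^bsub>pairs_ring A\<^esub> = frag_of (1, \<one>\<^bsub>A\<^esub>)"
  "\<zero>\<^bsub>pairs_ring A\<^esub> = 0"
  "p \<oplus>\<^bsub>pairs_ring A\<^esub> q = p + q"
  by (simp_all add: pairs_ring_def free_Abelian_group_def pairs_mult_def frag_extend_def
      frag_cmul_sum frag_cmul_single)

lemma pairs_mult_of [simp]:
  "pairs_mult A (frag_of u) (frag_of v) = frag_of (fst u * fst v, snd u \<otimes>\<^bsub>A\<^esub> snd v)"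
  by (simp add: pairs_mult_def)

lemma frag_cmul_diff_right: "frag_cmul c (x - y) = frag_cmul c x - frag_cmul c y"
  by (rule poly_mapping_eqI) (simp add: lookup_minus algebra_simps)

lemma frag_extend_fun_diff:
  "frag_extend (\<lambda>u. f u - g u) p = frag_extend f p - frag_extend g p"
  by (simp add: frag_extend_def sum_subtractf frag_cmul_diff_right)

lemma pairs_mult_diff_left: "pairs_mult A (p - p') q = pairs_mult A p q - pairs_mult A p' q"
  by (simp add: pairs_mult_def frag_extend_diff)

lemma pairs_mult_diff_right: "pairs_mult A p (q - q') = pairs_mult A p q - pairs_mult A p q'"
  by (simp add: pairs_mult_def frag_extend_diff frag_extend_fun_diff)

lemma pairs_mult_0 [simp]: "pairs_mult A 0 q = 0" "pairs_mult A p 0 = 0"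
  using pairs_mult_diff_left[of A 0 0 q] pairs_mult_diff_right[of A p 0 0] by simp_all

lemma pairs_mult_add_left: "pairs_mult A (p + p') q = pairs_mult A p q + pairs_mult A p' q"
  using pairs_mult_diff_left[of A "p + p'" p' q] by (simp add: algebra_simps)

lemma pairs_mult_add_right: "pairs_mult A p (q + q') = pairs_mult A p q + pairs_mult A p q'"
  using pairs_mult_diff_right[of A p "q + q'" q'] by (simp add: algebra_simps)

lemma ring_pairs_ring:
  assumes "ring A"
  shows "ring (pairs_ring A :: (('c::field \<times> 'a) \<Rightarrow>\<^sub>0 int) ring)"
proof -
  interpret A: ring A by fact
  let ?S = "(UNIV :: 'c set) \<times> carrier A"
  have closed: "Poly_Mapping.keys (pairs_mult A p q) \<subseteq> ?S"
    if "Poly_Mapping.keys p \<subseteq> ?S" "Poly_Mapping.keys q \<subseteq> ?S" for p q :: "('c \<times> 'a) \<Rightarrow>\<^sub>0 int"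
    using that unfolding pairs_mult_def
    by (intro order_trans[OF keys_frag_extend] UN_least) fastforce
  have assoc: "pairs_mult A (pairs_mult A p q) r = pairs_mult A p (pairs_mult A q r)"
    if p: "Poly_Mapping.keys p \<subseteq> ?S" and q: "Poly_Mapping.keys q \<subseteq> ?S"
      and r: "Poly_Mapping.keys r \<subseteq> ?S"
    for p q r :: "('c \<times> 'a) \<Rightarrow>\<^sub>0 int"
    using p
  proof (induction p rule: frag_induction)
    case (one u)
    show ?case
      using q
    proof (induction q rule: frag_induction)
      case (one v)
      show ?case
        using r by (induction r rule: frag_induction)
          (use one \<open>u \<in> ?S\<close> in \<open>auto simp: pairs_mult_diff_right A.m_assoc mult.assoc\<close>)
    qed (simp_all add: pairs_mult_diff_left pairs_mult_diff_right)
  qed (simp_all add: pairs_mult_diff_left)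
  have one_left: "pairs_mult A (frag_of (1, \<one>\<^bsub>A\<^esub>)) p = p" if "Poly_Mapping.keys p \<subseteq> ?S" for p
    using that by (induction p rule: frag_induction) (auto simp: pairs_mult_diff_right)
  have one_right: "pairs_mult A p (frag_of (1, \<one>\<^bsub>A\<^esub>)) = p" if "Poly_Mapping.keys p \<subseteq> ?S" for p
    using that by (induction p rule: frag_induction) (auto simp: pairs_mult_diff_left)
  have keys_plus: "Poly_Mapping.keys (p + q) \<subseteq> ?S"
    if "Poly_Mapping.keys p \<subseteq> ?S" "Poly_Mapping.keys q \<subseteq> ?S" for p q :: "('c \<times> 'a) \<Rightarrow>\<^sub>0 int"
    using that keys_add[of p q] by blast
  have inverse: "\<exists>q\<in>carrier (pairs_ring A). q + p = 0"
    if "Poly_Mapping.keys p \<subseteq> ?S" for p :: "('c \<times> 'a) \<Rightarrow>\<^sub>0 int"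
    using that by (intro bexI[of _ "- p"]) (auto simp: in_keys_iff)
  show ?thesis
    by (intro ringI abelian_groupI monoidI; unfold pairs_ring_simps;
        (fact closed | fact keys_plus | fact assoc | fact one_left | fact one_right | fact inverse
          | simp add: pairs_mult_add_left pairs_mult_add_right add.assoc add.commute)?)
qed


section \<open>Generators of a scalar extension\<close>

locale scalar_extension = ring A
  for A :: "('k::field, 'a, 'm) module_scheme" (structure) +
  fixes \<iota> :: "'k \<Rightarrow> 'c::field"
  assumes smult_closed: "a \<in> carrier A \<Longrightarrow> c \<odot> a \<in> carrier A"
begin

text \<open>Membership in \<open>K\<close> of a formal combination of pairs means that the corresponding tensors sum to zero.\<close>
abbreviation (input) K where "K \<equiv> tensor_kernel \<iota> A"

lemma tensor_relations_carrier:
  "tensor_relations \<iota> A \<subseteq> carrier (free_Abelian_group (UNIV \<times> carrier A))"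
proof
  fix r :: "('c \<times> 'a) \<Rightarrow>\<^sub>0 int"
  assume "r \<in> tensor_relations \<iota> A"
  then obtain u v w where r: "r = u - v - w" and
    "{Poly_Mapping.keys u, Poly_Mapping.keys v, Poly_Mapping.keys w} \<subseteq> Pow (UNIV \<times> carrier A)"
    unfolding tensor_relations_def
  proof (elim UnE CollectE exE conjE, goal_cases)
    case (3 x c a)
    then show ?case
      by (intro 3(1)[of "frag_of (x * \<iota> c, a)" "frag_of (x, c \<odot> a)" 0])
        (auto intro: smult_closed)
  qed auto
  then show "r \<in> carrier (free_Abelian_group (UNIV \<times> carrier A))"
    unfolding r free_Abelian_group_def
    using keys_diff[of "u - v" w] keys_diff[of u v] by simp blast
qed

lemma subgroup_kernel: "subgroup K (free_Abelian_group (UNIV \<times> carrier A))"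
  unfolding tensor_kernel_def
  by (rule group.generate_is_subgroup) (use tensor_relations_carrier in simp_all)

lemma kernel_carrier: "p \<in> K \<Longrightarrow> Poly_Mapping.keys p \<subseteq> UNIV \<times> carrier A"
  using subgroup.subset[OF subgroup_kernel] by (auto simp: free_Abelian_group_def)

lemma kernel_zero: "0 \<in> K"
  using subgroup.one_closed[OF subgroup_kernel] by simp

lemma kernel_add: "p \<in> K \<Longrightarrow> q \<in> K \<Longrightarrow> p + q \<in> K"
  using subgroup.m_closed[OF subgroup_kernel] by simp

lemma kernel_minus: "p \<in> K \<Longrightarrow> - p \<in> K"
  using subgroup.m_inv_closed[OF subgroup_kernel, of p] kernel_carrier[of p] by simp

lemma kernel_diff: "p \<in> K \<Longrightarrow> q \<in> K \<Longrightarrow> p - q \<in> K"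
  using kernel_add[of p "- q"] kernel_minus[of q] by simp

lemma kernel_sum: "(\<And>i. i \<in> I \<Longrightarrow> p i \<in> K) \<Longrightarrow> (\<Sum>i\<in>I. p i) \<in> K"
  by (induction I rule: infinite_finite_induct) (auto intro: kernel_zero kernel_add)

lemma kernel_relations:
  assumes "a \<in> carrier A"
  shows "frag_of (x + y, a) - frag_of (x, a) - frag_of (y, a) \<in> K"
    and "b \<in> carrier A \<Longrightarrow> frag_of (x, a \<oplus> b) - frag_of (x, a) - frag_of (x, b) \<in> K"
    and "frag_of (x * \<iota> c, a) - frag_of (x, c \<odot> a) \<in> K"
  using assms unfolding tensor_kernel_def tensor_relations_def
  by (auto intro!: generate.incl)

lemma frag_of_zero_kernel:
  shows "frag_of (x, \<zero>) \<in> K" and "a \<in> carrier A \<Longrightarrow> frag_of (0, a) \<in> K"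
proof -
  show "frag_of (x, \<zero>) \<in> K"
    using kernel_minus[OF kernel_relations(2)[OF zero_closed zero_closed, of x]] by simp
  show "frag_of (0, a) \<in> K" if "a \<in> carrier A"
    using kernel_minus[OF kernel_relations(1)[OF that, of 0 0]] by simp
qed

lemma frag_of_finsum_kernel:
  assumes "finite I" and "\<And>i. i \<in> I \<Longrightarrow> t i \<in> carrier A"
  shows "frag_of (x, \<Oplus>i\<in>I. c i \<odot> t i) - (\<Sum>i\<in>I. frag_of (x * \<iota> (c i), t i)) \<in> K"
  using assms
proof (induction I rule: finite_induct)
  case empty
  then show ?case by (simp add: frag_of_zero_kernel)
next
  case (insert i I)
  let ?S = "\<Oplus>i\<in>I. c i \<odot> t i"
  have car: "c i \<odot> t i \<in> carrier A" "?S \<in> carrier A"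
    using insert.prems by (auto intro!: smult_closed finsum_closed)
  have eq: "(\<Oplus>i\<in>insert i I. c i \<odot> t i) = c i \<odot> t i \<oplus> ?S"
    using insert by (intro finsum_insert) (auto intro: smult_closed)
  have "(frag_of (x, c i \<odot> t i \<oplus> ?S) - frag_of (x, c i \<odot> t i) - frag_of (x, ?S))
      + (frag_of (x, ?S) - (\<Sum>i\<in>I. frag_of (x * \<iota> (c i), t i)))
      - (frag_of (x * \<iota> (c i), t i) - frag_of (x, c i \<odot> t i)) \<in> K"
    using insert car by (intro kernel_diff[OF kernel_add] kernel_relations insert.IH) auto
  then show ?case
    unfolding eq using insert.hyps by (simp add: algebra_simps)
qed

text \<open>
  Moving the scalars of \<open>'k\<close> across the tensor sign collapses any formal combination to one
  coefficient per generator. This is what bounds the tensor product from above: a map that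
  separates these normal forms has no kernel beyond \<open>K\<close>.
\<close>
lemma normal_form:
  assumes I: "finite I" "\<And>i. i \<in> I \<Longrightarrow> t i \<in> carrier A"
    and gen: "\<And>a. a \<in> carrier A \<Longrightarrow> \<exists>c. a = (\<Oplus>i\<in>I. c i \<odot> t i)"
    and p: "Poly_Mapping.keys p \<subseteq> UNIV \<times> carrier A"
  shows "\<exists>x. p - (\<Sum>i\<in>I. frag_of (x i, t i)) \<in> K"
  using p
proof (induction p rule: frag_induction)
  case zero
  have "(\<Sum>i\<in>I. frag_of (0, t i)) \<in> K"
    using I by (intro kernel_sum frag_of_zero_kernel(2)) auto
  then show ?case
    using kernel_minus by (intro exI[of _ "\<lambda>_. 0"]) simp
next
  case (one u)
  obtain x a where u: "u = (x, a)" "a \<in> carrier A"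
    using one by (cases u) auto
  obtain c where "a = (\<Oplus>i\<in>I. c i \<odot> t i)"
    using gen[OF u(2)] by blast
  then show ?case
    unfolding u(1) using frag_of_finsum_kernel[of I t x c] I
    by (intro exI[of _ "\<lambda>i. x * \<iota> (c i)"]) simp
next
  case (diff p q)
  then obtain x y where xy: "p - (\<Sum>i\<in>I. frag_of (x i, t i)) \<in> K"
      "q - (\<Sum>i\<in>I. frag_of (y i, t i)) \<in> K"
    by blast
  have "(\<Sum>i\<in>I. frag_of (x i - y i + y i, t i) - frag_of (x i - y i, t i) - frag_of (y i, t i)) \<in> K"
    using I by (intro kernel_sum kernel_relations) auto
  from kernel_add[OF this kernel_diff[OF xy]]
  have "p - q - (\<Sum>i\<in>I. frag_of (x i - y i, t i)) \<in> K"
    by (simp add: sum_subtractf sum.distrib algebra_simps)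
  then show ?case by (intro exI[of _ "\<lambda>i. x i - y i"])
qed

end


section \<open>Recognising a scalar extension\<close>
lemma base_change_simps:
  "carrier (base_change \<iota> A) = carrier (pairs_ring A Quot tensor_kernel \<iota> A)"
  "monoid.mult (base_change \<iota> A) = monoid.mult (pairs_ring A Quot tensor_kernel \<iota> A)"
  "monoid.one (base_change \<iota> A) = monoid.one (pairs_ring A Quot tensor_kernel \<iota> A)"
  "ring.zero (base_change \<iota> A) = ring.zero (pairs_ring A Quot tensor_kernel \<iota> A)"
  "ring.add (base_change \<iota> A) = ring.add (pairs_ring A Quot tensor_kernel \<iota> A)"
  "module.smult (base_change \<iota> A) c Y = monoid.mult (pairs_ring A Quot tensor_kernel \<iota> A) (tensor \<iota> A c \<one>\<^bsub>A\<^esub>) Y"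
  by (simp_all add: base_change_def Let_def)

text \<open>The additive map on formal pairs that sends \<open>(x, a)\<close> to \<open>x\<close> times \<open>\<psi> a\<close>.\<close>
definition pairs_ext ::
  "('c::field \<Rightarrow> 'v::ab_group_add \<Rightarrow> 'v) \<Rightarrow> ('a \<Rightarrow> 'v \<Rightarrow> 'v) \<Rightarrow> (('c \<times> 'a) \<Rightarrow>\<^sub>0 int) \<Rightarrow> 'v \<Rightarrow> 'v"
  where "pairs_ext s \<psi> p v =
    (\<Sum>u\<in>Poly_Mapping.keys p. s (of_int (Poly_Mapping.lookup p u) * fst u) (\<psi> (snd u) v))"

text \<open>
  An \<open>\<iota>\<close>-semilinear ring homomorphism \<open>\<psi>\<close> from \<open>A\<close> to an endomorphism algebra over the larger
  field which carries a finite generating family of \<open>A\<close> to a basis. This makes the target a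
  model of the scalar extension of \<open>A\<close>.
\<close>
locale base_change_target = scalar_extension A \<iota> + T: vector_space s
  for A :: "('k::field, 'a, 'm) module_scheme" (structure)
    and \<iota> :: "'k \<Rightarrow> 'c::field"
    and s :: "'c \<Rightarrow> 'v::ab_group_add \<Rightarrow> 'v" +
  fixes \<psi> :: "'a \<Rightarrow> 'v \<Rightarrow> 'v" and I :: "'i set" and t :: "'i \<Rightarrow> 'a"
  assumes \<psi>_hom: "\<psi> \<in> ring_hom A (End_alg s)"
    and \<psi>_smult: "a \<in> carrier A \<Longrightarrow> \<psi> (c \<odot> a) v = s (\<iota> c) (\<psi> a v)"
    and finite_I: "finite I"
    and t_carrier: "i \<in> I \<Longrightarrow> t i \<in> carrier A"
    and t_generates: "a \<in> carrier A \<Longrightarrow> \<exists>c. a = (\<Oplus>i\<in>I. c i \<odot> t i)"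
    and t_independent: "(\<And>v. (\<Sum>i\<in>I. s (x i) (\<psi> (t i) v)) = 0) \<Longrightarrow> i \<in> I \<Longrightarrow> x i = 0"
    and t_spans: "Vector_Spaces.linear s s f \<Longrightarrow> \<exists>x. \<forall>v. f v = (\<Sum>i\<in>I. s (x i) (\<psi> (t i) v))"
begin

abbreviation (input) \<Phi> where "\<Phi> \<equiv> pairs_ext s \<psi>"

lemma \<psi>_linear: "a \<in> carrier A \<Longrightarrow> Vector_Spaces.linear s s (\<psi> a)"
  using ring_hom_closed[OF \<psi>_hom] by simp

lemma \<Phi>_of [simp]: "\<Phi> (frag_of (x, a)) v = s x (\<psi> a v)"
  by (simp add: pairs_ext_def)

lemma \<Phi>_0 [simp]: "\<Phi> 0 v = 0"
  by (simp add: pairs_ext_def)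

lemma \<Phi>_add: "\<Phi> (p + q) v = \<Phi> p v + \<Phi> q v"
  unfolding pairs_ext_def
  by (rule setsum_keys_plus_distrib) (simp_all add: algebra_simps)

lemma \<Phi>_diff: "\<Phi> (p - q) v = \<Phi> p v - \<Phi> q v"
  using \<Phi>_add[of "p - q" q v] by simp

lemma \<Phi>_minus: "\<Phi> (- p) v = - \<Phi> p v"
  using \<Phi>_diff[of 0 p v] by simp

lemma \<Phi>_sum: "\<Phi> (\<Sum>i\<in>J. p i) v = (\<Sum>i\<in>J. \<Phi> (p i) v)"
  by (induction J rule: infinite_finite_induct) (simp_all add: \<Phi>_add)

lemma \<Phi>_linear:
  assumes "Poly_Mapping.keys p \<subseteq> UNIV \<times> carrier A"
  shows "Vector_Spaces.linear s s (\<Phi> p)"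
  using assms
proof (induction p rule: frag_induction)
  case (one u)
  then show ?case
    using \<psi>_linear[of "snd u"]
    by (cases u) (auto simp: linear_self_iff[OF T.vector_space_axioms] T.scale_right_distrib mult.commute)
qed (simp_all add: linear_self_iff[OF T.vector_space_axioms] \<Phi>_diff algebra_simps)

lemma \<Phi>_mult:
  assumes p: "Poly_Mapping.keys p \<subseteq> UNIV \<times> carrier A"
    and q: "Poly_Mapping.keys q \<subseteq> UNIV \<times> carrier A"
  shows "\<Phi> (pairs_mult A p q) v = \<Phi> p (\<Phi> q v)"
  using p
proof (induction p rule: frag_induction)
  case (one u)
  obtain x a where u: "u = (x, a)" "a \<in> carrier A" using one by (cases u) auto
  have lin: "\<psi> a (v + w) = \<psi> a v + \<psi> a w" "\<psi> a (s c v) = s c (\<psi> a v)"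
    "\<psi> a (v - w) = \<psi> a v - \<psi> a w" "\<psi> a 0 = 0" for v w c
  proof -
    interpret f: Vector_Spaces.linear s s "\<psi> a" using \<psi>_linear u by blast
    show "\<psi> a (v + w) = \<psi> a v + \<psi> a w" "\<psi> a (s c v) = s c (\<psi> a v)"
      "\<psi> a (v - w) = \<psi> a v - \<psi> a w" "\<psi> a 0 = 0"
      by (simp_all add: f.add f.scale f.diff f.zero)
  qed
  show ?case
    using q
  proof (induction q rule: frag_induction)
    case (one w)
    then show ?case
      using ring_hom_mult[OF \<psi>_hom u(2), of "snd w"] by (cases w) (auto simp: u(1) lin)
  qed (simp_all add: u(1) lin pairs_mult_diff_right \<Phi>_diff T.scale_right_diff_distrib)
qed (simp_all add: pairs_mult_diff_left \<Phi>_diff)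

lemma \<Phi>_hom: "\<Phi> \<in> ring_hom (pairs_ring A) (End_alg s)"
  by (rule ring_hom_memI)
    (use ring_hom_one[OF \<psi>_hom] in \<open>auto simp: \<Phi>_linear \<Phi>_mult \<Phi>_add fun_eq_iff\<close>)

lemma \<Phi>_kernel:
  assumes "p \<in> K"
  shows "\<Phi> p v = 0"
proof -
  have rel: "\<Phi> r v = 0" if "r \<in> tensor_relations \<iota> A" for r
    using that ring_hom_add[OF \<psi>_hom]
    unfolding tensor_relations_def
    by (elim UnE CollectE exE conjE)
      (simp_all add: \<Phi>_diff \<psi>_smult T.scale_left_distrib T.scale_right_distrib)
  have car: "r \<in> carrier (free_Abelian_group (UNIV \<times> carrier A))"
    if "r \<in> tensor_relations \<iota> A" for r
    using that tensor_relations_carrier by blast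
  show ?thesis
    using assms unfolding tensor_kernel_def
    by (induction rule: generate.induct) (use car in \<open>simp_all add: \<Phi>_add \<Phi>_minus rel\<close>)
qed

text \<open>
  Injectivity on the tensor product: an element of the kernel has a normal form over the family
  \<open>t\<close>, and the independence of the \<open>\<psi> (t i)\<close> forces its coefficients to vanish.
\<close>
lemma a_kernel_\<Phi>: "a_kernel (pairs_ring A) (End_alg s) \<Phi> = K"
proof (intro equalityI subsetI)
  fix p assume "p \<in> a_kernel (pairs_ring A) (End_alg s) \<Phi>"
  then have p: "Poly_Mapping.keys p \<subseteq> UNIV \<times> carrier A" "\<Phi> p v = 0" for v
    by (auto simp: a_kernel_def' fun_eq_iff)
  obtain x where x: "p - (\<Sum>i\<in>I. frag_of (x i, t i)) \<in> K"
    using normal_form[OF finite_I t_carrier t_generates p(1)] by blast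
  have "(\<Sum>i\<in>I. s (x i) (\<psi> (t i) v)) = 0" for v
    using \<Phi>_kernel[OF x, of v] p(2) by (simp add: \<Phi>_diff \<Phi>_sum)
  then have "x i = 0" if "i \<in> I" for i
    using t_independent that by blast
  then have "(\<Sum>i\<in>I. frag_of (x i, t i)) \<in> K"
    by (intro kernel_sum) (simp add: frag_of_zero_kernel t_carrier)
  from kernel_add[OF x this] show "p \<in> K" by simp
next
  fix p assume "p \<in> K"
  then show "p \<in> a_kernel (pairs_ring A) (End_alg s) \<Phi>"
    using kernel_carrier[of p] \<Phi>_kernel[of p] by (auto simp: a_kernel_def' fun_eq_iff)
qed

lemma \<Phi>_surj: "\<Phi> ` carrier (pairs_ring A) = carrier (End_alg s)"
proof (intro equalityI subsetI)
  fix f assume "f \<in> carrier (End_alg s)"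
  then obtain x where x: "\<And>v. f v = (\<Sum>i\<in>I. s (x i) (\<psi> (t i) v))"
    using t_spans[of f] by auto
  have "Poly_Mapping.keys (\<Sum>i\<in>I. frag_of (x i, t i)) \<subseteq> UNIV \<times> carrier A"
    using keys_sum[of "\<lambda>i. frag_of (x i, t i)" I] t_carrier by fastforce
  moreover have "f = \<Phi> (\<Sum>i\<in>I. frag_of (x i, t i))"
    by (simp add: fun_eq_iff x \<Phi>_sum)
  ultimately show "f \<in> \<Phi> ` carrier (pairs_ring A)"
    by (intro image_eqI) simp_all
qed (use \<Phi>_linear in auto)

text \<open>The map induced by \<open>\<Phi>\<close> on cosets of \<open>K\<close>.\<close>
definition \<Theta> where "\<Theta> Y = the_elem (\<Phi> ` Y)"

lemma \<Theta>_tensor: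
  assumes "a \<in> carrier A"
  shows "\<Theta> (tensor \<iota> A x a) = (\<lambda>v. s x (\<psi> a v))"
proof -
  have "\<Phi> ` tensor \<iota> A x a = {\<lambda>v. s x (\<psi> a v)}"
    using kernel_zero \<Phi>_kernel by (auto simp: tensor_def a_r_coset_def' fun_eq_iff \<Phi>_add image_iff)
  then show ?thesis by (simp add: \<Theta>_def)
qed

lemma tensor_carrier: "a \<in> carrier A \<Longrightarrow> tensor \<iota> A x a \<in> carrier (base_change \<iota> A)"
  by (auto simp: base_change_simps FactRing_def A_RCOSETS_def' tensor_def)

lemma ring_hom_ring_\<Phi>: "ring_hom_ring (pairs_ring A) (End_alg s) \<Phi>"
  by (intro ring_hom_ringI2 ring_pairs_ring ring_End_alg \<Phi>_hom)
    (simp_all add: ring_axioms T.vector_space_axioms)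

lemma \<Theta>_ring_iso: "\<Theta> \<in> ring_iso (base_change \<iota> A) (End_alg s)"
proof -
  have "\<Theta> \<in> ring_iso (pairs_ring A Quot K) (End_alg s)"
    using ring_hom_ring.FactRing_iso_set[OF ring_hom_ring_\<Phi> \<Phi>_surj]
    unfolding a_kernel_\<Phi> \<Theta>_def .
  then show ?thesis
    by (simp add: ring_iso_def ring_hom_def base_change_simps)
qed

lemma \<Theta>_algebra_iso: "\<Theta> \<in> algebra_iso (base_change \<iota> A) (End_alg s)"
proof -
  have hom: "\<Theta> \<in> ring_hom (base_change \<iota> A) (End_alg s)"
    using \<Theta>_ring_iso by (simp add: ring_iso_def)
  have "\<Theta> (c \<odot>\<^bsub>base_change \<iota> A\<^esub> Y) = c \<odot>\<^bsub>End_alg s\<^esub> \<Theta> Y"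
    if "Y \<in> carrier (base_change \<iota> A)" for c Y
    using ring_hom_mult[OF hom tensor_carrier[OF one_closed] that] ring_hom_one[OF \<psi>_hom]
    by (simp add: base_change_simps \<Theta>_tensor comp_def)
  then show ?thesis
    using \<Theta>_ring_iso by (simp add: algebra_iso_def)
qed

lemma \<Theta>_base_change_grading:
  assumes "gr d \<subseteq> carrier A"
  shows "\<Theta> ` base_change_grading \<iota> A gr d
    = generate (add_monoid (End_alg s)) {\<lambda>v. s x (\<psi> a v) | x a. a \<in> gr d}"
proof -
  have "ideal K (pairs_ring A)"
    using ring_hom_ring.kernel_is_ideal[OF ring_hom_ring_\<Phi>] by (simp add: a_kernel_\<Phi>)
  then interpret Q: ring "pairs_ring A Quot K"
    by (rule ideal.quotient_is_ring)
  interpret E: ring "End_alg s"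
    by (rule ring_End_alg) (rule T.vector_space_axioms)
  have "group (add_monoid (base_change \<iota> A))"
    using Q.a_group
    by (simp add: group_def monoid_def group_axioms_def Units_def base_change_simps)
  then have "group_hom (add_monoid (base_change \<iota> A)) (add_monoid (End_alg s)) \<Theta>"
    using \<Theta>_ring_iso E.a_group
    by (simp add: group_hom_def group_hom_axioms_def hom_def ring_iso_def ring_hom_def)
  moreover have "{tensor \<iota> A x a | x a. a \<in> gr d} \<subseteq> carrier (add_monoid (base_change \<iota> A))"
    using assms tensor_carrier by auto
  moreover have "\<Theta> ` {tensor \<iota> A x a | x a. a \<in> gr d} = {\<lambda>v. s x (\<psi> a v) | x a. a \<in> gr d}"
  proof -
    have "{tensor \<iota> A x a | x a. a \<in> gr d} = (\<lambda>(x, a). tensor \<iota> A x a) ` (UNIV \<times> gr d)"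
      "{\<lambda>v. s x (\<psi> a v) | x a. a \<in> gr d} = (\<lambda>(x, a) v. s x (\<psi> a v)) ` (UNIV \<times> gr d)"
      by auto
    then show ?thesis
      using assms \<Theta>_tensor by (simp only: image_image) (intro image_cong, auto)
  qed
  ultimately show ?thesis
    unfolding base_change_grading_def by (simp only: group_hom.generate_img[symmetric])
qed

end


section \<open>Finiteness and dual bases\<close>

text \<open>
  Over a nontrivial commutative ring the identity matrix of size \<open>n + 1\<close> does not factor through
  size \<open>n\<close>: padding the factors with a zero column and a zero row makes them square, and one of the
  determinants vanishes.
\<close>
lemma identity_not_through_smaller:
  fixes A :: "'n::finite option \<Rightarrow> 'n \<Rightarrow> 'a::comm_ring_1" and S :: "'n \<Rightarrow> 'n option \<Rightarrow> 'a"
  assumes "\<And>i j. (\<Sum>k\<in>UNIV. A i k * S k j) = (if i = j then 1 else 0)"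
  shows False
proof -
  define A' :: "'a^'n option^'n option" where "A' = (\<chi> i j. case j of None \<Rightarrow> 0 | Some k \<Rightarrow> A i k)"
  define S' :: "'a^'n option^'n option" where "S' = (\<chi> i j. case i of None \<Rightarrow> 0 | Some k \<Rightarrow> S k j)"
  have "A' ** S' = mat 1"
    by (simp add: matrix_matrix_mult_def mat_def A'_def S'_def UNIV_option_conv sum.reindex
        assms vec_eq_iff)
  then have "det A' * det S' = 1"
    by (simp flip: det_mul)
  moreover have "det S' = 0"
    unfolding det_def
    by (intro sum.neutral ballI) (simp add: S'_def UNIV_option_conv prod.insert_remove)
  ultimately show False by simp
qed

lemma lookup_Abs_poly_mapping_finite [simp]:
  "Poly_Mapping.lookup (Abs_poly_mapping f) = (f :: 'a::finite \<Rightarrow> 'b::zero)"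
  by (simp add: Abs_poly_mapping_inverse)

context algebra_with_action
begin

lemma act_0 [simp]: "act \<sigma> 0 = 0"
  using act_scale[of \<sigma> 0 0] by simp

lemma act_sum: "act \<sigma> (\<Sum>i\<in>I. f i) = (\<Sum>i\<in>I. act \<sigma> (f i))"
  by (induction I rule: infinite_finite_induct) (simp_all add: act_add)

lemma mult_scale_right: "x * scale c y = scale c (x * y)"
  using scale_mult_left[of c y x] by (simp add: mult.commute)

lemma skew_to_End_sum: "skew_to_End act t x = (\<Sum>\<sigma>\<in>UNIV. Poly_Mapping.lookup t \<sigma> * act \<sigma> x)"
  unfolding skew_to_End_def by (rule sum.mono_neutral_left) (auto simp: in_keys_iff)

end

context galois_extension
begin

lemma linear_eq_sum_act:
  assumes "Vector_Spaces.linear scale scale f"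
  obtains \<alpha> where "\<And>x. f x = (\<Sum>\<sigma>\<in>UNIV. \<alpha> \<sigma> * act \<sigma> x)"
proof -
  have "bij_betw (skew_to_End act) (carrier (skew_group_alg scale act)) (carrier (End_alg scale))"
    using skew_to_End_iso by (simp add: algebra_iso_def ring_iso_def)
  then have "f \<in> skew_to_End act ` carrier (skew_group_alg scale act)"
    using assms by (simp add: bij_betw_def)
  then show ?thesis using that by (auto simp: skew_to_End_sum)
qed

lemma sum_act_inject:
  assumes "\<And>x. (\<Sum>\<sigma>\<in>UNIV. \<alpha> \<sigma> * act \<sigma> x) = (\<Sum>\<sigma>\<in>UNIV. \<beta> \<sigma> * act \<sigma> x)"
  shows "\<alpha> = \<beta>"
proof -
  have "bij_betw (skew_to_End act) (carrier (skew_group_alg scale act)) (carrier (End_alg scale))"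
    using skew_to_End_iso by (simp add: algebra_iso_def ring_iso_def)
  then have "inj (skew_to_End act)"
    by (simp add: bij_betw_def skew_group_alg_def)
  moreover have "skew_to_End act (Abs_poly_mapping \<alpha>) = skew_to_End act (Abs_poly_mapping \<beta>)"
    using assms by (simp add: fun_eq_iff skew_to_End_sum)
  ultimately have "Abs_poly_mapping \<alpha> = Abs_poly_mapping \<beta>"
    by (rule injD)
  then show ?thesis
    by (metis lookup_Abs_poly_mapping_finite)
qed

text \<open>
  Every endomorphism is an \<open>l\<close>-combination of the \<open>n\<close> maps \<open>act \<sigma>\<close>. If there were \<open>n + 1\<close> independent
  vectors, then expanding the endomorphisms that pick them out one at a time would factor an
  identity matrix over \<open>l\<close> through size \<open>n\<close>.
\<close>
lemma finite_independent:
  assumes B: "independent B"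
  shows "finite B"
proof (rule ccontr)
  assume "infinite B"
  then obtain T where T: "T \<subseteq> B" "finite T" "card T = CARD('h option)"
    using infinite_arbitrarily_large by blast
  obtain b where b: "bij_betw b (UNIV :: 'h option set) T"
    using finite_same_card_bij[of "UNIV :: 'h option set" T] T by auto
  interpret vector_space_pair scale scale ..
  have "\<exists>\<alpha>. \<forall>j. (\<Sum>\<sigma>\<in>UNIV. \<alpha> \<sigma> * act \<sigma> (b j)) = (if i = j then 1 else 0)" for i
  proof -
    obtain g where g: "Vector_Spaces.linear scale scale g"
      "\<And>x. x \<in> B \<Longrightarrow> g x = (if x = b i then 1 else 0)"
      using linear_independent_extend[OF B, of "\<lambda>x. if x = b i then 1 else 0"] by auto
    obtain \<alpha> where "\<And>x. g x = (\<Sum>\<sigma>\<in>UNIV. \<alpha> \<sigma> * act \<sigma> x)"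
      using linear_eq_sum_act[OF g(1)] by blast
    moreover have "g (b j) = (if i = j then 1 else 0)" for j
    proof -
      have "b j \<in> B" "b j = b i \<longleftrightarrow> i = j"
        using b T(1) by (auto simp: bij_betw_def inj_def)
      then show ?thesis using g(2) by simp
    qed
    ultimately show ?thesis by (intro exI[of _ \<alpha>]) simp
  qed
  then obtain \<alpha> where "\<And>i j. (\<Sum>\<sigma>\<in>UNIV. \<alpha> i \<sigma> * act \<sigma> (b j)) = (if i = j then 1 else 0)"
    by metis
  then show False by (rule identity_not_through_smaller)
qed

text \<open>
  The coordinate functional of \<open>b\<close> takes values in \<open>k\<close>, so it is fixed by composition with \<open>act \<tau>\<close>.
  Uniqueness of coefficients then forces it to have the form \<open>x \<mapsto> \<Sum>\<sigma>. act \<sigma> (a b * x)\<close>: every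
  functional is a trace form. The two displayed identities say that the matrices
  \<open>act \<sigma> b\<close> and \<open>act \<sigma> (a b)\<close>, with rows and columns indexed by the group and by \<open>B\<close>, are inverse
  to each other up to transposition.
\<close>
lemma dual_bases:
  obtains B a where "finite B" "independent B" "span B = UNIV"
    "\<And>\<sigma>. (\<Sum>b\<in>B. b * act \<sigma> (a b)) = (if \<sigma> = 0 then 1 else 0)"
    "\<And>b c. b \<in> B \<Longrightarrow> c \<in> B \<Longrightarrow> (\<Sum>\<sigma>\<in>UNIV. act \<sigma> (a b * c)) = (if b = c then 1 else 0)"
proof -
  obtain B where B: "independent B" "span B = UNIV"
    using basis_exists[of UNIV] by (metis top.extremum_unique)
  have fin: "finite B" using finite_independent B(1) .
  define e where "e b x = scale (representation B x b) 1" for b x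
  have "Vector_Spaces.linear scale scale (e b)" for b
    unfolding linear_self_iff[OF vector_space_axioms] e_def
    using B by (simp add: representation_add representation_scale scale_left_distrib)
  then have "\<exists>\<alpha>. \<forall>x. e b x = (\<Sum>\<sigma>\<in>UNIV. \<alpha> \<sigma> * act \<sigma> x)" for b
    using linear_eq_sum_act by metis
  then obtain \<alpha> where \<alpha>: "\<And>b x. e b x = (\<Sum>\<sigma>\<in>UNIV. \<alpha> b \<sigma> * act \<sigma> x)"
    by metis
  have shift: "\<alpha> b \<sigma> = act \<tau> (\<alpha> b (- \<tau> + \<sigma>))" for b \<sigma> \<tau>
  proof -
    have "\<alpha> b = (\<lambda>\<sigma>. act \<tau> (\<alpha> b (- \<tau> + \<sigma>)))"
    proof (rule sum_act_inject)
      fix x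
      have "(\<Sum>\<sigma>\<in>UNIV. \<alpha> b \<sigma> * act \<sigma> x) = act \<tau> (\<Sum>\<sigma>\<in>UNIV. \<alpha> b \<sigma> * act \<sigma> x)"
        unfolding \<alpha>[symmetric] by (simp add: e_def act_scale act_one)
      also have "\<dots> = (\<Sum>\<sigma>\<in>UNIV. act \<tau> (\<alpha> b \<sigma>) * act (\<tau> + \<sigma>) x)"
        by (simp add: act_sum act_mult act_compose)
      also have "\<dots> = (\<Sum>\<sigma>\<in>UNIV. act \<tau> (\<alpha> b (- \<tau> + \<sigma>)) * act \<sigma> x)"
        by (rule sum.reindex_bij_witness[of _ "\<lambda>\<sigma>. - \<tau> + \<sigma>" "\<lambda>\<sigma>. \<tau> + \<sigma>"])
          (simp_all flip: add.assoc)
      finally show "(\<Sum>\<sigma>\<in>UNIV. \<alpha> b \<sigma> * act \<sigma> x)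
          = (\<Sum>\<sigma>\<in>UNIV. act \<tau> (\<alpha> b (- \<tau> + \<sigma>)) * act \<sigma> x)" .
    qed
    then show ?thesis by (rule fun_cong)
  qed
  have \<alpha>_act: "act \<sigma> (\<alpha> b 0) = \<alpha> b \<sigma>" for b \<sigma>
    using shift[of b \<sigma> \<sigma>] by simp
  show ?thesis
  proof (rule that[OF fin B, of "\<lambda>b. \<alpha> b 0"])
    fix b c assume "b \<in> B" "c \<in> B"
    then have "e b c = (if b = c then 1 else 0)"
      using B by (simp add: e_def representation_basis)
    then show "(\<Sum>\<sigma>\<in>UNIV. act \<sigma> (\<alpha> b 0 * c)) = (if b = c then 1 else 0)"
      by (simp add: act_mult \<alpha>_act \<alpha>)
  next
    have "(\<lambda>\<sigma>. \<Sum>b\<in>B. b * act \<sigma> (\<alpha> b 0)) = (\<lambda>\<sigma>. if \<sigma> = 0 then 1 else 0)"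
    proof (rule sum_act_inject)
      fix x
      have "(\<Sum>\<sigma>\<in>UNIV. (\<Sum>b\<in>B. b * act \<sigma> (\<alpha> b 0)) * act \<sigma> x) = (\<Sum>b\<in>B. b * e b x)"
        unfolding \<alpha> \<alpha>_act sum_distrib_left sum_distrib_right
        by (subst sum.swap) (simp add: mult.assoc)
      also have "\<dots> = (\<Sum>b\<in>B. scale (representation B x b) b)"
        by (simp add: e_def mult_scale_right)
      also have "\<dots> = x"
        using B fin by (intro sum_representation_eq) auto
      also have "\<dots> = (\<Sum>\<sigma>\<in>UNIV. (if \<sigma> = 0 then 1 else 0) * act \<sigma> x)"
        by (simp add: if_distrib[of "\<lambda>z. z * _"] act_zero cong: if_cong)
      finally show "(\<Sum>\<sigma>\<in>UNIV. (\<Sum>b\<in>B. b * act \<sigma> (\<alpha> b 0)) * act \<sigma> x)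
          = (\<Sum>\<sigma>\<in>UNIV. (if \<sigma> = 0 then 1 else 0) * act \<sigma> x)" .
    qed
    then show "(\<Sum>b\<in>B. b * act \<sigma> (\<alpha> b 0)) = (if \<sigma> = 0 then 1 else 0)" for \<sigma>
      by (rule fun_cong)
  qed
qed

end


section \<open>A point over the algebraic closure\<close>

context
  fixes f :: "'l::comm_ring_1 \<Rightarrow> 'c::field" and a :: 'l
begin

text \<open>
  The element \<open>a\<close> acts on functionals by precomposing with multiplication by \<open>a\<close>; this is the value
  at \<open>x\<close> of the functional obtained by applying the polynomial \<open>q\<close> in that operator to \<open>f\<close>.
\<close>
definition poly_act :: "'c poly \<Rightarrow> 'l \<Rightarrow> 'c"
  where "poly_act q x = (\<Sum>i\<le>degree q. coeff q i * f (a ^ i * x))"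

lemma poly_act_bound:
  assumes "degree q \<le> n"
  shows "poly_act q x = (\<Sum>i\<le>n. coeff q i * f (a ^ i * x))"
  unfolding poly_act_def using assms
  by (intro sum.mono_neutral_left) (auto simp: coeff_eq_0)

lemma poly_act_linear_factor:
  "poly_act ([:- z, 1:] * q) x = poly_act q (a * x) - z * poly_act q x"
proof -
  let ?n = "degree q"
  have "degree ([:- z, 1:] * q) \<le> Suc ?n"
    using degree_mult_le[of "[:- z, 1:]" q] by simp
  then have "poly_act ([:- z, 1:] * q) x
      = (\<Sum>i\<le>Suc ?n. coeff (pCons 0 q - smult z q) i * f (a ^ i * x))"
    by (simp add: poly_act_bound algebra_simps)
  also have "\<dots> = (\<Sum>i\<le>Suc ?n. coeff (pCons 0 q) i * f (a ^ i * x))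
      - z * (\<Sum>i\<le>Suc ?n. coeff q i * f (a ^ i * x))"
    by (simp add: sum_subtractf sum_distrib_left algebra_simps del: sum.atMost_Suc)
  also have "(\<Sum>i\<le>Suc ?n. coeff (pCons 0 q) i * f (a ^ i * x)) = poly_act q (a * x)"
    by (simp add: poly_act_def sum.atMost_Suc_shift mult.assoc power_Suc2
        del: sum.atMost_Suc power_Suc)
  also have "(\<Sum>i\<le>Suc ?n. coeff q i * f (a ^ i * x)) = poly_act q x"
    by (simp add: poly_act_bound[of q "Suc ?n"] del: sum.atMost_Suc)
  finally show ?thesis .
qed

end

text \<open>
  If \<open>q\<close> annihilates \<open>f\<close>, split off linear factors of \<open>q\<close> one by one. The last nonzero functional
  obtained before reaching zero is an eigenvector. Having it of the form \<open>poly_act f a r\<close> matters: it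
  keeps every eigenvalue relation that \<open>f\<close> already satisfies for other elements.
\<close>
lemma eigenfunctional_exists:
  fixes f :: "'l::comm_ring_1 \<Rightarrow> 'c::alg_closed_field"
  assumes f: "f x\<^sub>0 \<noteq> 0" and q: "q \<noteq> 0" "\<And>x. poly_act f a q x = 0"
  shows "\<exists>r z y. poly_act f a r y \<noteq> 0 \<and> (\<forall>x. poly_act f a r (a * x) = z * poly_act f a r x)"
    using q
  proof (induction "degree q" arbitrary: q rule: less_induct)
    case less
    have "degree q \<noteq> 0"
    proof
      assume "degree q = 0"
      then obtain c where "q = [:c:]" by (rule degree_eq_zeroE)
      with less.prems f show False by (auto simp: poly_act_def)
    qed
    then obtain z where "poly q z = 0"
      using alg_closed_imp_poly_has_root by blast
    then obtain r where r: "q = [:- z, 1:] * r"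
      by (auto simp: poly_eq_0_iff_dvd)
    have "r \<noteq> 0" using r less.prems(1) by auto
    show ?case
    proof (cases "\<forall>x. poly_act f a r x = 0")
      case True
      have "degree r < degree q"
        using \<open>r \<noteq> 0\<close> unfolding r by (subst degree_mult_eq) auto
      then show ?thesis using less.hyps \<open>r \<noteq> 0\<close> True by blast
    next
      case False
      moreover have "poly_act f a r (a * x) = z * poly_act f a r x" for x
        using less.prems(2)[of x] unfolding r poly_act_linear_factor by simp
      ultimately show ?thesis by blast
    qed
  qed

locale field_hom_into_closed =
  fixes \<iota> :: "'k::field \<Rightarrow> 'c::alg_closed_field"
  assumes \<iota>_one: "\<iota> 1 = 1"
    and \<iota>_add: "\<iota> (x + y) = \<iota> x + \<iota> y"
    and \<iota>_mult: "\<iota> (x * y) = \<iota> x * \<iota> y"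
begin

lemma \<iota>_zero [simp]: "\<iota> 0 = 0"
  using \<iota>_add[of 0 0] by (metis add.right_neutral add_left_cancel)

lemma \<iota>_eq_0_iff [simp]: "\<iota> x = 0 \<longleftrightarrow> x = 0"
proof
  assume "\<iota> x = 0"
  then show "x = 0"
    using \<iota>_mult[of x "inverse x"] \<iota>_one by (cases "x = 0") auto
qed simp

end

locale algebra_and_field_hom = field_hom_into_closed \<iota> + vector_space scale
  for \<iota> :: "'k::field \<Rightarrow> 'c::alg_closed_field"
    and scale :: "'k \<Rightarrow> 'l::comm_ring_1 \<Rightarrow> 'l" +
  assumes scale_mult: "scale c x * y = scale c (x * y)"
begin

definition semilinear :: "('l \<Rightarrow> 'c) \<Rightarrow> bool"
  where "semilinear f \<longleftrightarrow> (\<forall>x y. f (x + y) = f x + f y) \<and> (\<forall>c x. f (scale c x) = \<iota> c * f x)"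

lemma semilinear_sum:
  assumes "semilinear f"
  shows "f (\<Sum>i\<in>I. x i) = (\<Sum>i\<in>I. f (x i))"
proof -
  have "f 0 = 0" using assms[unfolded semilinear_def, THEN conjunct2, rule_format, of 0 0] by simp
  then show ?thesis
    using assms by (induction I rule: infinite_finite_induct) (simp_all add: semilinear_def)
qed

lemma scale_mult_right: "x * scale c y = scale c (x * y)"
  using scale_mult[of c y x] by (simp add: mult.commute)

text \<open>Each element satisfies a polynomial relation, because its powers cannot all be independent.\<close>
lemma algebraic_element:
  assumes "finite B" "span B = UNIV"
  obtains N and u :: "nat \<Rightarrow> 'k" where "\<exists>i\<le>N. u i \<noteq> 0" "(\<Sum>i\<le>N. scale (u i) (a ^ i)) = 0"
proof -
  let ?N = "card B"
  show ?thesis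
  proof (cases "inj_on (\<lambda>i. a ^ i) {..?N}")
    case True
    let ?S = "(\<lambda>i. a ^ i) ` {..?N}"
    have "card ?S = Suc ?N" using True by (simp add: card_image)
    then have "dependent ?S"
      using independent_span_bound[OF assms(1), of ?S] assms(2) by auto
    then obtain w where w: "\<exists>v\<in>?S. w v \<noteq> 0" "(\<Sum>v\<in>?S. scale (w v) v) = 0"
      by (subst (asm) dependent_finite) auto
    show ?thesis
      using w(1) w(2) by (intro that[of ?N "\<lambda>i. w (a ^ i)"]) (auto simp: sum.reindex[OF True])
  next
    case False
    then obtain i' j' where "i' \<noteq> j'" "a ^ i' = a ^ j'"
      by (auto simp: inj_on_def)
    then obtain i j where ij: "i < j" "a ^ i = a ^ j"
      by (metis linorder_neqE_nat)
    have "(\<Sum>m\<le>j. scale ((if m = j then 1 else 0) - (if m = i then 1 else 0)) (a ^ m)) = a ^ j - a ^ i"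
      using ij(1) by (simp add: scale_left_diff_distrib sum_subtractf if_distrib[of "\<lambda>c. scale c _"]
          cong: if_cong)
    then show ?thesis
      using ij by (intro that[of j "\<lambda>m. (if m = j then 1 else 0) - (if m = i then 1 else 0)"]) auto
  qed
qed

text \<open>
  Multiplications commute, so eigenvalue relations can be imposed for one element after another.
\<close>
lemma common_eigenfunctional:
  assumes B: "finite B" "independent B" "span B = UNIV" and "finite S"
  shows "\<exists>f. semilinear f \<and> (\<exists>x. f x \<noteq> 0) \<and> (\<forall>a\<in>S. \<exists>\<mu>. \<forall>x. f (a * x) = \<mu> * f x)"
  using assms(4)
proof (induction S rule: finite_induct)
  case empty
  have "B \<noteq> {}"
  proof
    assume "B = {}"
    then have "(1 :: 'l) \<in> span {}" using B(3) by simp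
    then show False by simp
  qed
  then obtain b where b: "b \<in> B" by blast
  let ?f = "\<lambda>x. \<iota> (representation B x b)"
  have "semilinear ?f"
    using B by (simp add: semilinear_def representation_add representation_scale \<iota>_add \<iota>_mult)
  moreover have "?f b \<noteq> 0"
    using B b by (simp add: representation_basis \<iota>_one)
  ultimately show ?case by blast
next
  case (insert a S)
  then obtain f x\<^sub>0 where f: "semilinear f" "f x\<^sub>0 \<noteq> 0"
    and eigen: "\<And>b. b \<in> S \<Longrightarrow> \<exists>\<mu>. \<forall>x. f (b * x) = \<mu> * f x"
    by blast
  obtain N u where u: "\<exists>i\<le>N. u i \<noteq> 0" "(\<Sum>i\<le>N. scale (u i) (a ^ i)) = 0"
    using algebraic_element[OF B(1,3)] .
  define q where "q = (\<Sum>i\<le>N. monom (\<iota> (u i)) i)"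
  have coeff_q: "coeff q i = (if i \<le> N then \<iota> (u i) else 0)" for i
    by (simp add: q_def coeff_sum)
  have q0: "q \<noteq> 0"
    using u(1) coeff_q by (metis \<iota>_eq_0_iff coeff_0)
  have "degree q \<le> N"
    using coeff_q by (intro degree_le) simp
  then have q_act: "poly_act f a q x = 0" for x
  proof -
    have "poly_act f a q x = (\<Sum>i\<le>N. f (scale (u i) (a ^ i) * x))"
      using f(1) \<open>degree q \<le> N\<close>
      by (simp add: poly_act_bound coeff_q semilinear_def scale_mult)
    also have "\<dots> = f ((\<Sum>i\<le>N. scale (u i) (a ^ i)) * x)"
      by (simp add: semilinear_sum[OF f(1)] sum_distrib_right)
    also have "\<dots> = 0"
      using semilinear_sum[OF f(1), of _ "{}"] by (simp add: u(2))
    finally show ?thesis .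
  qed
  obtain r z y where r: "poly_act f a r y \<noteq> 0"
    "\<And>x. poly_act f a r (a * x) = z * poly_act f a r x"
    using eigenfunctional_exists[of f x\<^sub>0 q a, OF f(2) q0 q_act] by blast
  have "semilinear (poly_act f a r)"
    using f(1) unfolding semilinear_def poly_act_def
    by (simp add: distrib_left sum.distrib scale_mult_right sum_distrib_left mult.left_commute)
  moreover have "\<exists>\<mu>. \<forall>x. poly_act f a r (b * x) = \<mu> * poly_act f a r x" if "b \<in> S" for b
  proof -
    obtain \<mu> where "\<And>x. f (b * x) = \<mu> * f x" using eigen \<open>b \<in> S\<close> by blast
    then have "poly_act f a r (b * x) = \<mu> * poly_act f a r x" for x
      by (simp add: poly_act_def sum_distrib_left mult.left_commute[of _ b] mult.left_commute[of _ \<mu>])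
    then show ?thesis by blast
  qed
  ultimately show ?case
    using r by (intro exI[of _ "poly_act f a r"]) blast
qed

text \<open>
  A functional \<open>f\<close> that is an eigenvector for all multiplications satisfies \<open>f (a * x) = \<mu> a * f x\<close>.
  Putting \<open>x = 1\<close> shows that \<open>\<mu>\<close> is \<open>f\<close> divided by \<open>f 1\<close>, and it is an algebra homomorphism.
\<close>
lemma point_exists:
  assumes B: "finite B" "independent B" "span B = UNIV"
  obtains \<pi> :: "'l \<Rightarrow> 'c" where "semilinear \<pi>" "\<pi> 1 = 1" "\<And>x y. \<pi> (x * y) = \<pi> x * \<pi> y"
proof -
  obtain f x\<^sub>0 where f: "semilinear f" "f x\<^sub>0 \<noteq> 0"
    and eigen: "\<And>a. a \<in> B \<Longrightarrow> \<exists>\<mu>. \<forall>x. f (a * x) = \<mu> * f x"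
    using common_eigenfunctional[OF B B(1)] by blast
  have "\<exists>\<mu>. \<forall>x. f (a * x) = \<mu> * f x" for a
  proof -
    have "a \<in> span B" using B(3) by simp
    then show ?thesis
    proof (induction rule: span_induct_alt)
      case base
      have "f 0 = 0" using semilinear_sum[OF f(1), of _ "{}"] by simp
      then show ?case by (intro exI[of _ 0]) simp
    next
      case (step c b y)
      then obtain \<mu> \<nu> where "\<And>x. f (b * x) = \<mu> * f x" "\<And>x. f (y * x) = \<nu> * f x"
        using eigen by blast
      then have "f ((scale c b + y) * x) = (\<iota> c * \<mu> + \<nu>) * f x" for x
        using f(1) by (simp add: semilinear_def distrib_right scale_mult)
      then show ?case by blast
    qed
  qed
  then obtain \<mu> where \<mu>: "\<And>a x. f (a * x) = \<mu> a * f x" by metis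
  have \<mu>1: "f a = \<mu> a * f 1" for a
    using \<mu>[of a 1] by simp
  have "f 1 \<noteq> 0"
    using f(2) \<mu>1[of x\<^sub>0] by auto
  show ?thesis
  proof (rule that[of "\<lambda>x. f x / f 1"])
    show "semilinear (\<lambda>x. f x / f 1)"
      using f(1) by (simp add: semilinear_def add_divide_distrib)
    show "f (x * y) / f 1 = f x / f 1 * (f y / f 1)" for x y
      using \<open>f 1 \<noteq> 0\<close> \<mu>[of x y] \<mu>1[of x] by simp
  qed (use \<open>f 1 \<noteq> 0\<close> in simp)
qed

end


section \<open>The homogeneous components of the good grading\<close>
lemma group_alg_scale_single:
  "group_alg_scale c (Poly_Mapping.single h d) = Poly_Mapping.single h (c * d)"
  by (rule poly_mapping_eqI) (simp add: lookup_group_alg_scale lookup_single when_def)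

text \<open>The endomorphism that sends the basis element \<open>h\<close> to \<open>m (\<sigma> + h)\<close> times \<open>\<sigma> + h\<close>.\<close>
definition weighted_shift :: "'h::{group_add,finite} \<Rightarrow> ('h \<Rightarrow> 'c::field) \<Rightarrow> ('h \<Rightarrow>\<^sub>0 'c) \<Rightarrow> ('h \<Rightarrow>\<^sub>0 'c)"
  where "weighted_shift \<sigma> m v = Abs_poly_mapping (\<lambda>g. m g * Poly_Mapping.lookup v (- \<sigma> + g))"

lemma lookup_weighted_shift [simp]:
  "Poly_Mapping.lookup (weighted_shift \<sigma> m v) g = m g * Poly_Mapping.lookup v (- \<sigma> + g)"
  by (simp add: weighted_shift_def)

lemma weighted_shift_linear:
  "Vector_Spaces.linear group_alg_scale group_alg_scale (weighted_shift \<sigma> m)"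
  unfolding linear_self_iff[OF vector_space_group_alg_scale]
  by (auto intro!: poly_mapping_eqI simp: lookup_add lookup_group_alg_scale algebra_simps)

lemma poly_mapping_eq_sum_single:
  "(v :: 'h::finite \<Rightarrow>\<^sub>0 'c::field) = (\<Sum>h\<in>UNIV. group_alg_scale (Poly_Mapping.lookup v h) (Poly_Mapping.single h 1))"
  by (rule poly_mapping_eqI) (simp add: lookup_sum group_alg_scale_single lookup_single when_def)

lemma END_grading_group_alg:
  fixes \<sigma> :: "'h::{group_add,finite}"
  shows "END_grading group_alg_scale group_alg_comp \<sigma> = range (weighted_shift \<sigma> :: ('h \<Rightarrow> 'c::field) \<Rightarrow> _)"
proof (intro equalityI subsetI)
  fix f :: "('h \<Rightarrow>\<^sub>0 'c) \<Rightarrow> ('h \<Rightarrow>\<^sub>0 'c)"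
  assume "f \<in> END_grading group_alg_scale group_alg_comp \<sigma>"
  then have lin: "Vector_Spaces.linear group_alg_scale group_alg_scale f"
    and deg: "\<And>h. f ` group_alg_comp h \<subseteq> group_alg_comp (\<sigma> + h)"
    by (auto simp: END_grading_def)
  interpret f: Vector_Spaces.linear group_alg_scale group_alg_scale f by (rule lin)
  have "\<exists>c. f (Poly_Mapping.single h 1) = Poly_Mapping.single (\<sigma> + h) c" for h
  proof -
    have "Poly_Mapping.single h 1 \<in> group_alg_comp h"
      by (auto simp: group_alg_comp_def group_alg_scale_single)
    then show ?thesis
      using deg[of h] by (force simp: group_alg_comp_def group_alg_scale_single)
  qed
  then obtain c where c: "\<And>h. f (Poly_Mapping.single h 1) = Poly_Mapping.single (\<sigma> + h) (c h)"
    by metis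
  have "f v = weighted_shift \<sigma> (\<lambda>g. c (- \<sigma> + g)) v" for v
  proof -
    have "f v = (\<Sum>h\<in>UNIV. group_alg_scale (Poly_Mapping.lookup v h) (Poly_Mapping.single (\<sigma> + h) (c h)))"
      by (subst poly_mapping_eq_sum_single[of v]) (simp add: f.sum f.scale c)
    also have "\<dots> = weighted_shift \<sigma> (\<lambda>g. c (- \<sigma> + g)) v"
    proof (rule poly_mapping_eqI)
      fix g
      have "\<sigma> + h = g \<longleftrightarrow> h = - \<sigma> + g" for h
        by (auto simp flip: add.assoc)
      then show "Poly_Mapping.lookup (\<Sum>h\<in>UNIV. group_alg_scale (Poly_Mapping.lookup v h)
            (Poly_Mapping.single (\<sigma> + h) (c h))) g
          = Poly_Mapping.lookup (weighted_shift \<sigma> (\<lambda>g. c (- \<sigma> + g)) v) g"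
        by (simp add: lookup_sum group_alg_scale_single lookup_single when_def)
    qed
    finally show ?thesis .
  qed
  then show "f \<in> range (weighted_shift \<sigma>)" by blast
next
  fix f :: "('h \<Rightarrow>\<^sub>0 'c) \<Rightarrow> ('h \<Rightarrow>\<^sub>0 'c)"
  assume "f \<in> range (weighted_shift \<sigma>)"
  then obtain m where f: "f = weighted_shift \<sigma> m" by blast
  have "weighted_shift \<sigma> m (Poly_Mapping.single h c) = Poly_Mapping.single (\<sigma> + h) (m (\<sigma> + h) * c)" for h c
  proof (rule poly_mapping_eqI)
    fix g
    have "h = - \<sigma> + g \<longleftrightarrow> \<sigma> + h = g"
      by (auto simp flip: add.assoc)
    then show "Poly_Mapping.lookup (weighted_shift \<sigma> m (Poly_Mapping.single h c)) g
        = Poly_Mapping.lookup (Poly_Mapping.single (\<sigma> + h) (m (\<sigma> + h) * c)) g"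
      by (auto simp: lookup_single when_def)
  qed
  then show "f \<in> END_grading group_alg_scale group_alg_comp \<sigma>"
    unfolding f by (auto simp: END_grading_def weighted_shift_linear group_alg_comp_def group_alg_scale_single)
qed

section \<open>Splitting a Galois extension\<close>
locale split_dual_bases =
  algebra_with_action scale act + algebra_and_field_hom \<iota> scale
  for scale :: "'k::field \<Rightarrow> 'l::comm_ring_1 \<Rightarrow> 'l"
    and act :: "'h::{group_add,finite} \<Rightarrow> 'l \<Rightarrow> 'l"
    and \<iota> :: "'k \<Rightarrow> 'c::alg_closed_field" +
  fixes B :: "'l set" and a :: "'l \<Rightarrow> 'l" and \<pi> :: "'l \<Rightarrow> 'c"
  assumes B: "finite B" "independent B" "span B = UNIV"
    and dual_left: "(\<Sum>b\<in>B. b * act \<sigma> (a b)) = (if \<sigma> = 0 then 1 else 0)"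
    and dual_right: "b \<in> B \<Longrightarrow> c \<in> B \<Longrightarrow> (\<Sum>\<sigma>\<in>UNIV. act \<sigma> (a b * c)) = (if b = c then 1 else 0)"
    and \<pi>: "semilinear \<pi>" and \<pi>_one: "\<pi> 1 = 1" and \<pi>_mult: "\<pi> (x * y) = \<pi> x * \<pi> y"
begin

sublocale W: vector_space "group_alg_scale :: 'c \<Rightarrow> ('h \<Rightarrow>\<^sub>0 'c) \<Rightarrow> _"
  by (rule vector_space_group_alg_scale)

lemmas \<pi>_sum = semilinear_sum[OF \<pi>]

lemma \<pi>_zero [simp]: "\<pi> 0 = 0"
  using \<pi>_sum[of _ "{}"] by simp

text \<open>
  The map \<open>\<beta>\<close> identifies \<open>c \<otimes> l\<close> with the functions on the group, \<open>x\<close> going to its values at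
  the translates of the point \<open>\<pi>\<close>. Translating by \<open>-g\<close> rather than \<open>g\<close> makes \<open>act \<sigma>\<close> correspond to the
  left shift by \<open>\<sigma>\<close>.
\<close>
definition \<beta> :: "'l \<Rightarrow> 'h \<Rightarrow>\<^sub>0 'c"
  where "\<beta> x = Abs_poly_mapping (\<lambda>g. \<pi> (act (- g) x))"

lemma lookup_\<beta> [simp]: "Poly_Mapping.lookup (\<beta> x) g = \<pi> (act (- g) x)"
  by (simp add: \<beta>_def)

lemma \<beta>_add: "\<beta> (x + y) = \<beta> x + \<beta> y"
  using \<pi> by (intro poly_mapping_eqI) (simp add: lookup_add act_add semilinear_def)

lemma \<beta>_scale: "\<beta> (scale c x) = group_alg_scale (\<iota> c) (\<beta> x)"
  using \<pi> by (intro poly_mapping_eqI) (simp add: lookup_group_alg_scale act_scale semilinear_def)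

lemma \<beta>_sum: "\<beta> (\<Sum>i\<in>I. f i) = (\<Sum>i\<in>I. \<beta> (f i))"
  by (rule poly_mapping_eqI) (simp add: lookup_sum act_sum \<pi>_sum)

text \<open>
  Coordinates with respect to the vectors \<open>\<beta> b\<close>, read off with the dual family \<open>a\<close>. That they are
  coordinates, and that the \<open>\<beta> b\<close> form a basis, are the two identities of the dual families after
  applying \<open>\<pi>\<close>: the trace identity gives independence, the other one gives the expansion of every
  vector.
\<close>
definition coord :: "'l \<Rightarrow> ('h \<Rightarrow>\<^sub>0 'c) \<Rightarrow> 'c"
  where "coord b v = (\<Sum>g\<in>UNIV. \<pi> (act (- g) (a b)) * Poly_Mapping.lookup v g)"

lemma coord_add: "coord b (v + w) = coord b v + coord b w"
  by (simp add: coord_def lookup_add distrib_left sum.distrib)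

lemma coord_scale: "coord b (group_alg_scale c v) = c * coord b v"
  by (simp add: coord_def lookup_group_alg_scale sum_distrib_left mult.left_commute)

lemma coord_sum: "coord b (\<Sum>i\<in>I. v i) = (\<Sum>i\<in>I. coord b (v i))"
proof -
  have "coord b 0 = 0" by (simp add: coord_def)
  then show ?thesis
    by (induction I rule: infinite_finite_induct) (simp_all add: coord_add)
qed

lemma coord_\<beta>:
  assumes "b \<in> B" "c \<in> B"
  shows "coord b (\<beta> c) = (if b = c then 1 else 0)"
proof -
  have "coord b (\<beta> c) = \<pi> (\<Sum>g\<in>UNIV. act (- g) (a b * c))"
    by (simp add: coord_def \<pi>_sum act_mult \<pi>_mult)
  also have "(\<Sum>g\<in>UNIV. act (- g) (a b * c)) = (\<Sum>g\<in>UNIV. act g (a b * c))"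
    by (rule sum.reindex_bij_witness[of _ uminus uminus]) simp_all
  finally show ?thesis
    using dual_right[OF assms] by (simp add: \<pi>_one)
qed

lemma coord_expansion: "v = (\<Sum>b\<in>B. group_alg_scale (coord b v) (\<beta> b))"
proof (rule poly_mapping_eqI)
  fix h
  have delta: "(\<Sum>b\<in>B. \<pi> (act (- h) b) * \<pi> (act (- g) (a b))) = (if g = h then 1 else 0)" for g
  proof -
    have "(\<Sum>b\<in>B. \<pi> (act (- h) b) * \<pi> (act (- g) (a b)))
        = \<pi> (act (- h) (\<Sum>b\<in>B. b * act (h - g) (a b)))"
      by (simp add: \<pi>_sum act_sum act_mult \<pi>_mult flip: act_compose add_uminus_conv_diff add.assoc)
    also have "\<dots> = (if g = h then 1 else 0)"
      unfolding dual_left by (auto simp: act_one \<pi>_one)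
    finally show ?thesis .
  qed
  have "Poly_Mapping.lookup (\<Sum>b\<in>B. group_alg_scale (coord b v) (\<beta> b)) h
      = (\<Sum>b\<in>B. \<Sum>g\<in>UNIV. (\<pi> (act (- h) b) * \<pi> (act (- g) (a b))) * Poly_Mapping.lookup v g)"
    by (simp add: lookup_sum lookup_group_alg_scale coord_def sum_distrib_left sum_distrib_right
        mult_ac)
  also have "\<dots> = (\<Sum>g\<in>UNIV. (\<Sum>b\<in>B. \<pi> (act (- h) b) * \<pi> (act (- g) (a b))) * Poly_Mapping.lookup v g)"
    unfolding sum_distrib_right by (rule sum.swap)
  also have "\<dots> = Poly_Mapping.lookup v h"
    unfolding delta by (simp add: if_distrib[of "\<lambda>z. z * _"] cong: if_cong)
  finally show "Poly_Mapping.lookup v h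
      = Poly_Mapping.lookup (\<Sum>b\<in>B. group_alg_scale (coord b v) (\<beta> b)) h"
    by simp
qed

lemma coord_sum_\<beta>:
  assumes "b \<in> B"
  shows "coord b (\<Sum>c\<in>B. group_alg_scale (x c) (\<beta> c)) = x b"
proof -
  have "coord b (\<Sum>c\<in>B. group_alg_scale (x c) (\<beta> c)) = (\<Sum>c\<in>B. if b = c then x c else 0)"
    unfolding coord_sum coord_scale using assms by (intro sum.cong) (simp_all add: coord_\<beta>)
  then show ?thesis using assms B(1) by simp
qed

text \<open>The transport of \<open>T\<close> along \<open>\<beta>\<close>, extended linearly from the basis \<open>\<beta> ` B\<close>.\<close>
definition \<psi> :: "('l \<Rightarrow> 'l) \<Rightarrow> ('h \<Rightarrow>\<^sub>0 'c) \<Rightarrow> ('h \<Rightarrow>\<^sub>0 'c)"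
  where "\<psi> T v = (\<Sum>b\<in>B. group_alg_scale (coord b v) (\<beta> (T b)))"

lemma \<psi>_linear: "Vector_Spaces.linear group_alg_scale group_alg_scale (\<psi> T)"
  unfolding linear_self_iff[OF vector_space_group_alg_scale]
  by (simp add: \<psi>_def coord_add coord_scale W.scale_left_distrib sum.distrib W.scale_sum_right)

lemma sum_representation: "(\<Sum>b\<in>B. scale (representation B x b) b) = x"
  using B by (intro sum_representation_eq) auto

lemma linear_expand:
  assumes "Vector_Spaces.linear scale scale T"
  shows "T x = (\<Sum>b\<in>B. scale (representation B x b) (T b))"
proof -
  interpret T: Vector_Spaces.linear scale scale T by fact
  have "T x = T (\<Sum>b\<in>B. scale (representation B x b) b)"
    by (simp add: sum_representation)
  then show ?thesis by (simp add: T.sum T.scale)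
qed

lemma \<psi>_\<beta>:
  assumes T: "Vector_Spaces.linear scale scale T"
  shows "\<psi> T (\<beta> x) = \<beta> (T x)"
proof -
  have "coord b (\<beta> x) = \<iota> (representation B x b)" if "b \<in> B" for b
  proof -
    have "\<beta> x = \<beta> (\<Sum>c\<in>B. scale (representation B x c) c)"
      by (simp add: sum_representation)
    also have "\<dots> = (\<Sum>c\<in>B. group_alg_scale (\<iota> (representation B x c)) (\<beta> c))"
      by (simp add: \<beta>_sum \<beta>_scale)
    finally show ?thesis
      using coord_sum_\<beta>[OF that] by simp
  qed
  then show ?thesis
    by (simp add: linear_expand[OF T, of x] \<psi>_def \<beta>_sum \<beta>_scale)
qed

lemma \<psi>_ring_hom: "\<psi> \<in> ring_hom (End_alg scale) (End_alg group_alg_scale)"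
proof (rule ring_hom_memI)
  fix S T assume "S \<in> carrier (End_alg scale)" "T \<in> carrier (End_alg scale)"
  then have lin: "Vector_Spaces.linear scale scale S" by simp
  interpret S: Vector_Spaces.linear group_alg_scale group_alg_scale "\<psi> S" by (rule \<psi>_linear)
  have "\<psi> (S \<circ> T) v = \<psi> S (\<psi> T v)" for v
  proof -
    have "\<psi> S (\<psi> T v) = (\<Sum>b\<in>B. group_alg_scale (coord b v) (\<psi> S (\<beta> (T b))))"
      unfolding \<psi>_def[of T] by (simp add: S.sum S.scale)
    then show ?thesis by (simp add: \<psi>_\<beta>[OF lin] \<psi>_def[of "S \<circ> T"])
  qed
  then show "\<psi> (S \<otimes>\<^bsub>End_alg scale\<^esub> T) = \<psi> S \<otimes>\<^bsub>End_alg group_alg_scale\<^esub> \<psi> T"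
    by (simp add: fun_eq_iff)
  show "\<psi> (S \<oplus>\<^bsub>End_alg scale\<^esub> T) = \<psi> S \<oplus>\<^bsub>End_alg group_alg_scale\<^esub> \<psi> T"
    by (simp add: fun_eq_iff \<psi>_def \<beta>_add W.scale_right_distrib sum.distrib)
next
  show "\<psi> \<one>\<^bsub>End_alg scale\<^esub> = \<one>\<^bsub>End_alg group_alg_scale\<^esub>"
    using coord_expansion by (auto simp: fun_eq_iff \<psi>_def)
qed (simp add: \<psi>_linear)

text \<open>The matrix units with respect to \<open>B\<close>: \<open>unit_map (b, c)\<close> sends \<open>c\<close> to \<open>b\<close> and the rest of \<open>B\<close> to \<open>0\<close>.\<close>
definition unit_map :: "'l \<times> 'l \<Rightarrow> 'l \<Rightarrow> 'l"
  where "unit_map = (\<lambda>(b, c) x. scale (representation B x c) b)"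

lemma unit_map_linear: "Vector_Spaces.linear scale scale (unit_map i)"
  unfolding linear_self_iff[OF vector_space_axioms] unit_map_def
  using B by (simp add: representation_add representation_scale scale_left_distrib split: prod.split)

lemma \<psi>_unit_map:
  assumes "c \<in> B"
  shows "\<psi> (unit_map (b, c)) v = group_alg_scale (coord c v) (\<beta> b)"
proof -
  have "\<psi> (unit_map (b, c)) v = (\<Sum>d\<in>B. if d = c then group_alg_scale (coord d v) (\<beta> b) else 0)"
    unfolding \<psi>_def unit_map_def using B assms
    by (intro sum.cong) (auto simp: representation_basis \<beta>_scale \<iota>_one)
  then show ?thesis using assms B(1) by simp
qed

sublocale bc: base_change_target "End_alg scale" \<iota> group_alg_scale \<psi> "B \<times> B" unit_map
proof -
  interpret E: ring "End_alg scale" by (rule ring_End_alg) (rule vector_space_axioms)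
  show "base_change_target (End_alg scale) \<iota> group_alg_scale \<psi> (B \<times> B) unit_map"
  proof
    show "c \<odot>\<^bsub>End_alg scale\<^esub> T \<in> carrier (End_alg scale)" if "T \<in> carrier (End_alg scale)" for c T
      using that by (simp add: linear_self_iff[OF vector_space_axioms] scale_right_distrib mult.commute)
    show "\<psi> \<in> ring_hom (End_alg scale) (End_alg group_alg_scale)"
      by (rule \<psi>_ring_hom)
    show "\<psi> (c \<odot>\<^bsub>End_alg scale\<^esub> T) v = group_alg_scale (\<iota> c) (\<psi> T v)"
      if "T \<in> carrier (End_alg scale)" for c T v
      by (simp add: \<psi>_def \<beta>_scale W.scale_sum_right mult.commute)
    show "finite (B \<times> B)" using B by simp
    show "unit_map i \<in> carrier (End_alg scale)" for i
      by (simp add: unit_map_linear)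
    show "\<exists>c. T = (\<Oplus>\<^bsub>End_alg scale\<^esub>i\<in>B \<times> B. c i \<odot>\<^bsub>End_alg scale\<^esub> unit_map i)"
      if "T \<in> carrier (End_alg scale)" for T
    proof -
      have lin: "Vector_Spaces.linear scale scale T" using that by simp
      let ?c = "\<lambda>(b, c). representation B (T c) b"
      have "Vector_Spaces.linear scale scale (?c i \<odot>\<^bsub>End_alg scale\<^esub> unit_map i)" for i
        using unit_map_linear[of i]
        by (simp add: linear_self_iff[OF vector_space_axioms] scale_right_distrib mult.commute)
      then have "(\<Oplus>\<^bsub>End_alg scale\<^esub>i\<in>B \<times> B. ?c i \<odot>\<^bsub>End_alg scale\<^esub> unit_map i)
          = (\<lambda>x. \<Sum>i\<in>B \<times> B. scale (?c i) (unit_map i x))"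
        using B(1) by (subst finsum_End_alg[OF vector_space_axioms]) auto
      also have "\<dots> = T"
      proof
        fix x
        have "T x = (\<Sum>c\<in>B. scale (representation B x c) (\<Sum>b\<in>B. scale (representation B (T c) b) b))"
          unfolding sum_representation by (rule linear_expand[OF lin])
        also have "\<dots> = (\<Sum>c\<in>B. \<Sum>b\<in>B. scale (?c (b, c)) (unit_map (b, c) x))"
          by (simp add: unit_map_def scale_sum_right mult.commute)
        also have "\<dots> = (\<Sum>i\<in>B \<times> B. scale (?c i) (unit_map i x))"
          by (subst sum.swap) (simp add: sum.cartesian_product case_prod_beta)
        finally show "(\<Sum>i\<in>B \<times> B. scale (?c i) (unit_map i x)) = T x" by simp
      qed
      finally show ?thesis by (intro exI[of _ ?c]) simp
    qed
    have expand_sum: "(\<Sum>i\<in>B \<times> B. group_alg_scale (x i) (\<psi> (unit_map i) v))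
        = (\<Sum>c\<in>B. group_alg_scale (coord c v) (\<Sum>b\<in>B. group_alg_scale (x (b, c)) (\<beta> b)))" for x v
    proof -
      have "(\<Sum>i\<in>B \<times> B. group_alg_scale (x i) (\<psi> (unit_map i) v))
          = (\<Sum>b\<in>B. \<Sum>c\<in>B. group_alg_scale (x (b, c)) (\<psi> (unit_map (b, c)) v))"
        by (simp add: sum.cartesian_product case_prod_beta)
      also have "\<dots> = (\<Sum>c\<in>B. \<Sum>b\<in>B. group_alg_scale (x (b, c)) (\<psi> (unit_map (b, c)) v))"
        by (rule sum.swap)
      finally show ?thesis
        by (simp add: \<psi>_unit_map W.scale_sum_right mult.commute cong: sum.cong)
    qed
    show "x i = 0"
      if zero: "\<And>v. (\<Sum>i\<in>B \<times> B. group_alg_scale (x i) (\<psi> (unit_map i) v)) = 0" and i: "i \<in> B \<times> B" for x i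
    proof -
      obtain b c where bc: "i = (b, c)" "b \<in> B" "c \<in> B" using i by blast
      \<comment> \<open>Evaluation at \<open>\<beta> c\<close> isolates the coefficients of the column \<open>c\<close>.\<close>
      have "(\<Sum>d\<in>B. group_alg_scale (coord d (\<beta> c)) (\<Sum>b\<in>B. group_alg_scale (x (b, d)) (\<beta> b)))
          = (\<Sum>d\<in>B. if d = c then \<Sum>b\<in>B. group_alg_scale (x (b, d)) (\<beta> b) else 0)"
        using bc(3) by (intro sum.cong) (auto simp: coord_\<beta>)
      then have "(\<Sum>b\<in>B. group_alg_scale (x (b, c)) (\<beta> b)) = 0"
        using zero[of "\<beta> c"] bc(3) B(1) by (simp add: expand_sum)
      then show ?thesis
        using coord_sum_\<beta>[OF bc(2), of "\<lambda>b. x (b, c)"] bc(1) by (simp add: coord_def)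
    qed
    show "\<exists>x. \<forall>v. f v = (\<Sum>i\<in>B \<times> B. group_alg_scale (x i) (\<psi> (unit_map i) v))"
      if f: "Vector_Spaces.linear group_alg_scale group_alg_scale f" for f
    proof -
      interpret f: Vector_Spaces.linear group_alg_scale group_alg_scale f by (rule f)
      have "(\<Sum>i\<in>B \<times> B. group_alg_scale ((\<lambda>(b, c). coord b (f (\<beta> c))) i) (\<psi> (unit_map i) v)) = f v" for v
      proof -
        have "(\<Sum>i\<in>B \<times> B. group_alg_scale ((\<lambda>(b, c). coord b (f (\<beta> c))) i) (\<psi> (unit_map i) v))
            = (\<Sum>c\<in>B. group_alg_scale (coord c v) (f (\<beta> c)))"
          unfolding expand_sum by (simp flip: coord_expansion)
        also have "\<dots> = f (\<Sum>c\<in>B. group_alg_scale (coord c v) (\<beta> c))"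
          by (simp add: f.sum f.scale)
        finally show ?thesis by (simp flip: coord_expansion)
      qed
      then show ?thesis
        by (intro exI[of _ "\<lambda>(b, c). coord b (f (\<beta> c))"]) simp
    qed
  qed
qed

text \<open>
  The reason why the two gradings match: multiplication by \<open>y\<close> becomes diagonal after splitting,
  and \<open>act \<sigma>\<close> becomes a shift by \<open>\<sigma>\<close>.
\<close>
lemma \<psi>_homogeneous: "\<psi> (\<lambda>x. y * act \<sigma> x) = weighted_shift \<sigma> (Poly_Mapping.lookup (\<beta> y))"
proof (intro ext poly_mapping_eqI)
  fix v g
  have "Poly_Mapping.lookup (\<psi> (\<lambda>x. y * act \<sigma> x) v) g
      = \<pi> (act (- g) y) * (\<Sum>b\<in>B. coord b v * \<pi> (act (- (- \<sigma> + g)) b))"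
    by (simp add: \<psi>_def lookup_sum lookup_group_alg_scale act_mult \<pi>_mult sum_distrib_left
        minus_add mult.left_commute flip: act_compose)
  also have "(\<Sum>b\<in>B. coord b v * \<pi> (act (- (- \<sigma> + g)) b)) = Poly_Mapping.lookup v (- \<sigma> + g)"
    by (subst (2) coord_expansion[of v]) (simp add: lookup_sum lookup_group_alg_scale)
  finally show "Poly_Mapping.lookup (\<psi> (\<lambda>x. y * act \<sigma> x) v) g
      = Poly_Mapping.lookup (weighted_shift \<sigma> (Poly_Mapping.lookup (\<beta> y)) v) g"
    by simp
qed

lemma transported_grading_eq: "transported_grading act \<sigma> = range (\<lambda>y x. y * act \<sigma> x)"
proof -
  have "skew_to_End act (Poly_Mapping.single \<sigma> y) = (\<lambda>x. y * act \<sigma> x)" for y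
    by (rule ext) (rule skew_to_End_single)
  moreover have "skew_group_alg_comp \<sigma> = range (Poly_Mapping.single \<sigma> :: 'l \<Rightarrow> _)"
    by (auto simp: skew_group_alg_comp_def)
  ultimately show ?thesis
    by (simp add: transported_grading_def image_image)
qed

text \<open>
  Homogeneous elements of degree \<open>\<sigma>\<close> reach every weight function \<open>m\<close>, because \<open>m\<close>, as a vector of
  the group algebra, expands in the \<open>\<beta> b\<close>.
\<close>
lemma generate_homogeneous:
  "generate (add_monoid (End_alg group_alg_scale))
      {\<lambda>v. group_alg_scale z (\<psi> T v) | z T. T \<in> transported_grading act \<sigma>}
    = range (weighted_shift \<sigma>)" (is "generate ?G ?X = _")
proof -
  interpret E: ring "End_alg (group_alg_scale :: 'c \<Rightarrow> ('h \<Rightarrow>\<^sub>0 'c) \<Rightarrow> _)"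
    by (rule ring_End_alg) (rule vector_space_group_alg_scale)
  have X: "?X = {weighted_shift \<sigma> (\<lambda>g. z * \<pi> (act (- g) y)) | z y. True}"
  proof -
    have eq: "(\<lambda>v. group_alg_scale z (\<psi> (\<lambda>x. y * act \<sigma> x) v)) = weighted_shift \<sigma> (\<lambda>g. z * \<pi> (act (- g) y))"
      for z y
      by (intro ext poly_mapping_eqI) (simp add: \<psi>_homogeneous lookup_group_alg_scale mult.assoc)
    have "?X = {\<lambda>v. group_alg_scale z (\<psi> (\<lambda>x. y * act \<sigma> x) v) | z y. True}"
      unfolding transported_grading_eq by blast
    then show ?thesis by (simp only: eq)
  qed
  have add: "weighted_shift \<sigma> m \<otimes>\<^bsub>?G\<^esub> weighted_shift \<sigma> m' = weighted_shift \<sigma> (\<lambda>g. m g + m' g)"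
    for m m' :: "'h \<Rightarrow> 'c"
    by (intro ext poly_mapping_eqI) (simp add: lookup_add distrib_right)
  have zero: "\<one>\<^bsub>?G\<^esub> = weighted_shift \<sigma> (\<lambda>_. 0)"
    by (intro ext poly_mapping_eqI) simp
  have "subgroup (range (weighted_shift \<sigma>)) ?G"
  proof (rule group.subgroupI[OF E.a_group])
    show "range (weighted_shift \<sigma>) \<subseteq> carrier ?G"
      by (auto simp: weighted_shift_linear)
    show "inv\<^bsub>?G\<^esub> f \<in> range (weighted_shift \<sigma>)" if f_in: "f \<in> range (weighted_shift \<sigma>)" for f
    proof -
      from f_in obtain m where f: "f = weighted_shift \<sigma> m" by blast
      have "weighted_shift \<sigma> (\<lambda>g. - m g) \<otimes>\<^bsub>?G\<^esub> f = \<one>\<^bsub>?G\<^esub>"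
        unfolding f add zero by simp
      then have "inv\<^bsub>?G\<^esub> f = weighted_shift \<sigma> (\<lambda>g. - m g)"
        by (rule group.inv_equality[OF E.a_group]) (simp_all add: f weighted_shift_linear)
      then show ?thesis by blast
    qed
    show "f \<otimes>\<^bsub>?G\<^esub> f' \<in> range (weighted_shift \<sigma>)"
      if ff': "f \<in> range (weighted_shift \<sigma>)" "f' \<in> range (weighted_shift \<sigma>)" for f f'
    proof -
      from ff' obtain m m' where "f = weighted_shift \<sigma> m" "f' = weighted_shift \<sigma> m'" by blast
      then have "f \<otimes>\<^bsub>?G\<^esub> f' = weighted_shift \<sigma> (\<lambda>g. m g + m' g)"
        by (simp only: add)
      then show ?thesis by blast
    qed
  qed blast
  moreover have "?X \<subseteq> range (weighted_shift \<sigma>)"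
    unfolding X by blast
  ultimately have "generate ?G ?X \<subseteq> range (weighted_shift \<sigma>)"
    by (intro group.generate_subgroup_incl[OF E.a_group])
  moreover have "weighted_shift \<sigma> m \<in> generate ?G ?X" for m
  proof -
    define x where "x b = coord b (Abs_poly_mapping m)" for b
    have gen: "weighted_shift \<sigma> (\<lambda>g. \<Sum>b\<in>J. x b * \<pi> (act (- g) b)) \<in> generate ?G ?X" for J
    proof (induction J rule: infinite_finite_induct)
      case (insert b J)
      have "weighted_shift \<sigma> (\<lambda>g. x b * \<pi> (act (- g) b)) \<in> generate ?G ?X"
        by (rule generate.incl) (use X in blast)
      from generate.eng[OF this insert.IH] show ?case
        unfolding add by (simp only: sum.insert[OF insert.hyps])
    qed (use generate.one[of ?G ?X] zero in \<open>simp_all only: sum.infinite sum.empty simp_thms\<close>)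
    have m_eq: "m = (\<lambda>g. \<Sum>b\<in>B. x b * \<pi> (act (- g) b))"
    proof
      fix g
      have "m g = Poly_Mapping.lookup (\<Sum>b\<in>B. group_alg_scale (x b) (\<beta> b)) g"
        unfolding x_def by (simp flip: coord_expansion)
      then show "m g = (\<Sum>b\<in>B. x b * \<pi> (act (- g) b))"
        by (simp add: lookup_sum lookup_group_alg_scale)
    qed
    show ?thesis by (subst m_eq) (rule gen)
  qed
  ultimately show ?thesis by blast
qed

lemma graded_iso:
  "bc.\<Theta> \<in> graded_algebra_iso (base_change \<iota> (End_alg scale))
      (base_change_grading \<iota> (End_alg scale) (transported_grading act))
      (End_alg group_alg_scale) (END_grading group_alg_scale group_alg_comp)"
proof -
  have carrier: "transported_grading act \<sigma> \<subseteq> carrier (End_alg scale)" for \<sigma>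
    unfolding transported_grading_eq
    by (auto simp: linear_self_iff[OF vector_space_axioms] act_add act_scale distrib_left mult_scale_right)
  have "bc.\<Theta> ` base_change_grading \<iota> (End_alg scale) (transported_grading act) \<sigma>
      = END_grading group_alg_scale group_alg_comp \<sigma>" for \<sigma>
    unfolding END_grading_group_alg generate_homogeneous[symmetric]
    by (rule bc.\<Theta>_base_change_grading) (rule carrier)
  then show ?thesis
    by (simp add: graded_algebra_iso_def bc.\<Theta>_algebra_iso)
qed

end

theorem mainTheorem8:
  fixes \<iota> :: "'k::field \<Rightarrow> 'c::alg_closed_field"
    and scale :: "'k \<Rightarrow> 'l::comm_ring_1 \<Rightarrow> 'l"
    and act :: "'h::{ab_group_add,finite} \<Rightarrow> 'l \<Rightarrow> 'l"
  assumes "algebraic_closure_map \<iota>"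
    and "galois_extension scale act"
  shows "graded_algebra_iso
      (base_change \<iota> (End_alg scale))
      (base_change_grading \<iota> (End_alg scale) (transported_grading act))
      (End_alg (group_alg_scale :: 'c \<Rightarrow> ('h \<Rightarrow>\<^sub>0 'c) \<Rightarrow> ('h \<Rightarrow>\<^sub>0 'c)))
      (END_grading group_alg_scale group_alg_comp) \<noteq> {}"
proof -
  interpret algebraic_closure_map \<iota> by fact
  interpret galois_extension scale act by fact
  interpret A: algebra_and_field_hom \<iota> scale
    by unfold_locales (simp_all add: map_one map_add map_mult scale_mult_left)
  show ?thesis
  proof (rule dual_bases)
    fix B a
    assume B: "finite B" "independent B" "span B = UNIV"
      and dual: "\<And>\<sigma>. (\<Sum>b\<in>B. b * act \<sigma> (a b)) = (if \<sigma> = 0 then 1 else 0)"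
        "\<And>b c. b \<in> B \<Longrightarrow> c \<in> B \<Longrightarrow> (\<Sum>\<sigma>\<in>UNIV. act \<sigma> (a b * c)) = (if b = c then 1 else 0)"
    show ?thesis
    proof (rule A.point_exists[OF B])
      fix \<pi>
      assume "A.semilinear \<pi>" "\<pi> 1 = 1" "\<And>x y. \<pi> (x * y) = \<pi> x * \<pi> y"
      with B dual interpret split_dual_bases scale act \<iota> B a \<pi>
        by unfold_locales auto
      show ?thesis using graded_iso by blast
    qed
  qed
qed

end
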